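(* Let $G=(V,E)$ be a directed network with source $s$, sink $t$ and capacity vector $c\in\mathbb{Z}_{\ge 0}^{|E|}$, and let $\widehat f\in\mathbb{Z}_{\ge0}^{|E|}$ be a predicted flow on $G$, which may violate capacity and/or flow-conservation constraints. Fix an augmenting-path subroutine for Ford–Fulkerson (e.g. BFS, as in Edmonds–Karp, or Dinic's blocking-flow subroutine), and let $T$ be the worst-case running time of Ford–Fulkerson on $G$ with this subroutine. Then Algorithm 1 (described in the context), seeded with $\widehat f$ and using the same subroutine, outputs a maximum feasible flow $f^*$ on $G$ within time $O(\min\{|E|\cdot\eta(\widehat f),\,T\})$.
   Context: A flow $f\in\mathbb{Z}_{\ge0}^{|E|}$ is feasible if $f_e\le c_e$ for every $e\in E$ and, for every $u\in V\setminus\{s,t\}$, $\sum_{e=(v,u)}f_e=\sum_{e=(u,w)}f_e$. Its value is $\nu(f)=\sum_{e=(s,u)}f_e$. Let $\mathcal F^*$ be the set of maximum-value feasible flows on $G$, and for any (possibly infeasible) $\widehat f$ define $\eta(\widehat f)=\min_{f^*\in\mathcal F^*}\|\widehat f-f^*\|_1$. For a flow $f$ with $f_e\le c_e$ for all $e$, the residual graph $G_f$ has, for each $e=(u,v)\in E$, an edge $(u,v)$ of residual capacity $c_e-f_e$ and a reverse edge $(v,u)$ of residual capacity $f_e$. For a node $u$, its excess $\mathsf{ex}_f(u)$ is (incoming flow minus outgoing flow) if positive and $0$ otherwise, and its deficit $\mathsf{def}_f(u)$ is (outgoing minus incoming) if positive and $0$ otherwise. $A'_f$ (resp. $B'_f$)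 is the set of nodes in $V\setminus\{s,t\}$ with positive excess (resp. deficit). A projection path is a path in $G_f$ all of whose edges have positive residual capacity. Algorithm 1: (1) For every edge with $\widehat f_e>c_e$ set $\widehat f_e\leftarrow c_e$; call the result $f$. (2) Feasibility projection: while $A'_f\cup B'_f\neq\emptyset$: if $A'_f\ne\emptyset$, let $p$ be a projection path from some $u\in A'_f$ to some $v\in B'_f$ if one exists, and otherwise a projection path from some $u\in A'_f$ to $s$; if $A'_f=\emptyset$, let $p$ be a projection path from $t$ to some $v\in B'_f$. With $w,w'$ the first and last nodes of $p$, send $\mu_p=\min\{\mathsf{ex}_f(w),\mathsf{def}_f(w'),\min_{e\in p}(\text{residual capacity of }e)\}$ units of flow along $p$ and update $f$, $G_f$, $A'_f$, $B'_f$. Projection paths are found by running the chosen augmenting-path subroutine on an auxiliary graph obtained from $G_f$ by adding a super source $s^*$ and super sink $t^*$ with arcs from $s^*$ to the intended start nodes (capacity equal to their excess) and from the intended end nodes to $t^*$, in three rounds: $A'_f$ to $B'_f$, then $A'_f$ to $s$, then $t$ to $B'_f$. (3) Run Ford–Fulkerson with the chosen subroutine on $G$ starting from the feasible flow $f$ until a maximum flow is reached, and output it.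
   Formalization: No edge enters s or leaves t; the subroutine costs O(|E|) per augmenting path; T is a bound T(|V|,|E|) valid for all starting residual networks with T(n+2,3m)=O(T(n,m)); η and |E| are read as max(1,η) and max(1,|E|). *)

theory Defs
  imports "Graph_Theory.Pair_Digraph" "HOL-Library.Extended_Nat"
begin

section \<open>Networks and flows\<close>

text \<open>
  Nodes are natural numbers, so that one subroutine can be run on networks of every size and fresh
  super terminals always exist.  Antiparallel edges and loops are allowed.
\<close>

type_synonym edge = "nat \<times> nat"
type_synonym flow = "edge \<Rightarrow> nat"

record network =
  net_graph :: "nat pair_pre_digraph"
  capacity :: "edge \<Rightarrow> nat"
  source :: nat
  sink :: nat

abbreviation nodes :: "network \<Rightarrow> nat set" where
  "nodes N \<equiv> pverts (net_graph N)"

abbreviation edges :: "network \<Rightarrow> edge set" where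
  "edges N \<equiv> parcs (net_graph N)"

text \<open>
  A source has no incoming and a sink no outgoing edges.  The value of a flow is the gross outflow
  of the source, so with edges entering the source a flow of maximum value could consist of cycles
  through the source, which no source-sink augmentation produces.
\<close>

definition is_network :: "network \<Rightarrow> bool" where
  "is_network N \<longleftrightarrow>
     pair_fin_digraph (net_graph N) \<and>
     source N \<in> nodes N \<and> sink N \<in> nodes N \<and> source N \<noteq> sink N \<and>
     (\<forall>e \<in> edges N. snd e \<noteq> source N \<and> fst e \<noteq> sink N)"

definition inflow :: "network \<Rightarrow> flow \<Rightarrow> nat \<Rightarrow> nat" where
  "inflow N f u = (\<Sum>e \<in> {e \<in> edges N. snd e = u}. f e)"

definition outflow :: "network \<Rightarrow> flow \<Rightarrow> nat \<Rightarrow> nat" where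
  "outflow N f u = (\<Sum>e \<in> {e \<in> edges N. fst e = u}. f e)"

definition within_capacity :: "network \<Rightarrow> flow \<Rightarrow> bool" where
  "within_capacity N f \<longleftrightarrow> (\<forall>e \<in> edges N. f e \<le> capacity N e)"

definition feasible :: "network \<Rightarrow> flow \<Rightarrow> bool" where
  "feasible N f \<longleftrightarrow> within_capacity N f \<and>
     (\<forall>u \<in> nodes N - {source N, sink N}. inflow N f u = outflow N f u)"

definition flow_value :: "network \<Rightarrow> flow \<Rightarrow> nat" where
  "flow_value N f = outflow N f (source N)"

definition max_flow :: "network \<Rightarrow> flow \<Rightarrow> bool" where
  "max_flow N f \<longleftrightarrow> feasible N f \<and> (\<forall>g. feasible N g \<longrightarrow> flow_value N g \<le> flow_value N f)"

definition l1_dist :: "network \<Rightarrow> flow \<Rightarrow> flow \<Rightarrow> nat" where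
  "l1_dist N f g = (\<Sum>e \<in> edges N. nat \<bar>int (f e) - int (g e)\<bar>)"

text \<open>The infimum is over a nonempty set of natural numbers, hence a minimum.\<close>

definition prediction_error :: "network \<Rightarrow> flow \<Rightarrow> nat" where
  "prediction_error N fh = (INF f \<in> {f. max_flow N f}. l1_dist N fh f)"

text \<open>Subtraction on natural numbers is truncated, which takes the positive part.\<close>

definition excess :: "network \<Rightarrow> flow \<Rightarrow> nat \<Rightarrow> nat" where
  "excess N f u = inflow N f u - outflow N f u"

definition deficit :: "network \<Rightarrow> flow \<Rightarrow> nat \<Rightarrow> nat" where
  "deficit N f u = outflow N f u - inflow N f u"

definition excess_nodes :: "network \<Rightarrow> flow \<Rightarrow> nat set" where
  "excess_nodes N f = {u \<in> nodes N - {source N, sink N}. excess N f u > 0}"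

definition deficit_nodes :: "network \<Rightarrow> flow \<Rightarrow> nat set" where
  "deficit_nodes N f = {u \<in> nodes N - {source N, sink N}. deficit N f u > 0}"


section \<open>Residual graphs and augmentation\<close>

text \<open>
  Residual arcs keep their identity: if the network has antiparallel edges, its residual graph has
  parallel arcs.
\<close>

datatype arc = Fwd edge | Bwd edge

primrec arc_tail :: "arc \<Rightarrow> nat" where
  "arc_tail (Fwd e) = fst e"
| "arc_tail (Bwd e) = snd e"

primrec arc_head :: "arc \<Rightarrow> nat" where
  "arc_head (Fwd e) = snd e"
| "arc_head (Bwd e) = fst e"

definition residual_graph :: "network \<Rightarrow> (nat, arc) pre_digraph" where
  "residual_graph N =
     \<lparr>verts = nodes N, arcs = Fwd ` edges N \<union> Bwd ` edges N, tail = arc_tail, head = arc_head\<rparr>"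

primrec residual_capacity :: "network \<Rightarrow> flow \<Rightarrow> arc \<Rightarrow> nat" where
  "residual_capacity N f (Fwd e) = (if e \<in> edges N then capacity N e - f e else 0)"
| "residual_capacity N f (Bwd e) = (if e \<in> edges N then f e else 0)"

definition augmenting_path :: "network \<Rightarrow> flow \<Rightarrow> arc list \<Rightarrow> bool" where
  "augmenting_path N f p \<longleftrightarrow>
     pre_digraph.apath (residual_graph N) (source N) p (sink N) \<and>
     (\<forall>a \<in> set p. residual_capacity N f a > 0)"

definition augment :: "network \<Rightarrow> flow \<Rightarrow> arc list \<Rightarrow> flow" where
  "augment N f p =
     (let \<mu> = Min (residual_capacity N f ` set p)
      in (\<lambda>e. if Fwd e \<in> set p then f e + \<mu> else if Bwd e \<in> set p then f e - \<mu> else f e))"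

fun augmenting_paths :: "network \<Rightarrow> flow \<Rightarrow> arc list list \<Rightarrow> bool" where
  "augmenting_paths N f [] \<longleftrightarrow> True"
| "augmenting_paths N f (p # ps) \<longleftrightarrow>
     augmenting_path N f p \<and> augmenting_paths N (augment N f p) ps"

fun augment_list :: "network \<Rightarrow> flow \<Rightarrow> arc list list \<Rightarrow> flow" where
  "augment_list N f [] = f"
| "augment_list N f (p # ps) = augment_list N (augment N f p) ps"


section \<open>Ford--Fulkerson with an augmenting-path subroutine\<close>

record residual_network =
  res_graph :: "(nat, arc) pre_digraph"
  res_capacity :: "arc \<Rightarrow> nat"
  res_source :: nat
  res_sink :: nat

definition residual_network :: "network \<Rightarrow> flow \<Rightarrow> residual_network" where
  "residual_network N f =
     \<lparr>res_graph = residual_graph N, res_capacity = residual_capacity N f,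
      res_source = source N, res_sink = sink N\<rparr>"

text \<open>
  A subroutine sees only the residual network, and returns paths to be augmented one after the other
  together with the number of steps it took: one path for a graph search such as breadth-first
  search, the paths of a blocking flow for Dinic.  No path is returned only if none exists.  A call
  costs \<open>O(|E|)\<close> per path returned (and \<open>O(|E|)\<close> if it fails); a blocking
  flow with \<open>k\<close> paths, found in \<open>O(|E| + k |V|)\<close> steps, satisfies
  this because only the nodes incident with an edge matter.
\<close>

type_synonym subroutine = "residual_network \<Rightarrow> arc list list \<times> nat"

definition augmenting_subroutine :: "subroutine \<Rightarrow> bool" where
  "augmenting_subroutine A \<longleftrightarrow>
     (\<exists>K. \<forall>N f ps \<tau>. is_network N \<and> within_capacity N f \<and> A (residual_network N f) = (ps, \<tau>) \<longrightarrow>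
        augmenting_paths N f ps \<and>
        (ps = [] \<longleftrightarrow> (\<nexists>p. augmenting_path N f p)) \<and>
        \<tau> \<le> K * max 1 (card (edges N)) * max 1 (length ps))"

text \<open>
  \<open>ff_loop A N f g \<tau>\<close>: the loop started with \<open>f\<close> stops with
  \<open>g\<close> after \<open>\<tau>\<close> steps.  Updating the flow costs one step
  per arc of each path.
\<close>

inductive ff_loop :: "subroutine \<Rightarrow> network \<Rightarrow> flow \<Rightarrow> flow \<Rightarrow> nat \<Rightarrow> bool"
  for A :: subroutine and N :: network where
  stop: "A (residual_network N f) = ([], \<tau>) \<Longrightarrow> ff_loop A N f f \<tau>"
| step: "A (residual_network N f) = (ps, \<tau>) \<Longrightarrow> ps \<noteq> [] \<Longrightarrow>
         ff_loop A N (augment_list N f ps) g \<tau>' \<Longrightarrow>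
         ff_loop A N f g (\<tau> + (\<Sum>p\<leftarrow>ps. length p) + \<tau>')"

text \<open>Setting up the residual network costs \<open>1 + |E|\<close> steps.\<close>

definition ford_fulkerson :: "subroutine \<Rightarrow> network \<Rightarrow> flow \<Rightarrow> flow \<Rightarrow> nat \<Rightarrow> bool" where
  "ford_fulkerson A N f g \<tau> \<longleftrightarrow> (\<exists>\<tau>'. ff_loop A N f g \<tau>' \<and> \<tau> = 1 + card (edges N) + \<tau>')"

text \<open>
  Worst case over all networks with at most \<open>n\<close> nodes and \<open>m\<close> edges and over all residual
  networks (of flows within the capacities) from which the loop may be started.  It is infinite
  if the running times are unbounded, as they may be when the capacities matter.
\<close>

definition ff_worst_time :: "subroutine \<Rightarrow> nat \<Rightarrow> nat \<Rightarrow> enat" where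
  "ff_worst_time A n m =
     (SUP \<tau> \<in> {\<tau>. \<exists>N f g. is_network N \<and> card (nodes N) \<le> n \<and> card (edges N) \<le> m \<and>
                    within_capacity N f \<and> ford_fulkerson A N f g \<tau>}. enat \<tau>)"


section \<open>Ford--Fulkerson seeded with a prediction\<close>

definition clip :: "network \<Rightarrow> flow \<Rightarrow> flow" where
  "clip N f = (\<lambda>e. if f e > capacity N e then capacity N e else f e)"

definition super_source :: "network \<Rightarrow> nat" where
  "super_source N = Max (nodes N) + 1"

definition super_sink :: "network \<Rightarrow> nat" where
  "super_sink N = Max (nodes N) + 2"

text \<open>
  The auxiliary networks used below have at most \<open>|V| + 2\<close> nodes and, if \<open>E\<close> is nonempty, at
  most \<open>3 |E|\<close> edges, since a node with excess (deficit) has an incoming (outgoing) edge.  They are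
  thus larger than the given network by a constant factor, and bounding the projection by the time
  of Ford--Fulkerson on networks of the given size requires that this time does not change by
  more than a constant factor under such a change of size.
\<close>

definition aux_network :: "network \<Rightarrow> flow \<Rightarrow> nat set \<Rightarrow> nat set \<Rightarrow> network" where
  "aux_network N f S D =
     \<lparr>net_graph =
        \<lparr>pverts = nodes N \<union> {super_source N, super_sink N},
         parcs = edges N \<union> {super_source N} \<times> S \<union> D \<times> {super_sink N}\<rparr>,
      capacity = (\<lambda>(u, v). if u = super_source N then excess N f v
                           else if v = super_sink N then deficit N f u
                           else capacity N (u, v)),
      source = super_source N, sink = super_sink N\<rparr>"

definition restrict_flow :: "network \<Rightarrow> flow \<Rightarrow> flow" where
  "restrict_flow N f = (\<lambda>e. if e \<in> edges N then f e else 0)"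

text \<open>
  One round of the projection from the nodes \<open>S\<close> to the nodes \<open>D\<close>: Ford--Fulkerson on the
  auxiliary network, starting with \<open>f\<close> on the original edges and \<open>0\<close> on the super arcs.
  Throughout, the remaining capacities of the super arcs at \<open>w\<close> and \<open>w'\<close> are the current
  \<open>excess\<close> of \<open>w\<close> and the current \<open>deficit\<close> of \<open>w'\<close>, so the bottleneck of an augmenting path is
  the minimum of these two and of the residual capacities on the projection path from \<open>w\<close> to \<open>w'\<close>.
\<close>

definition projection_round ::
  "subroutine \<Rightarrow> network \<Rightarrow> nat set \<Rightarrow> nat set \<Rightarrow> flow \<Rightarrow> flow \<Rightarrow> nat \<Rightarrow> bool" where
  "projection_round A N S D f g \<tau> \<longleftrightarrow>
     (\<exists>h. ford_fulkerson A (aux_network N f S D) (restrict_flow N f) h \<tau> \<and> g = restrict_flow N h)"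

definition seeded_ford_fulkerson ::
  "subroutine \<Rightarrow> network \<Rightarrow> flow \<Rightarrow> flow \<Rightarrow> nat \<Rightarrow> bool" where
  "seeded_ford_fulkerson A N fh g \<tau> \<longleftrightarrow>
     (\<exists>f0 f1 f2 f3 \<tau>1 \<tau>2 \<tau>3 \<tau>4.
        f0 = clip N fh \<and>
        projection_round A N (excess_nodes N f0) (deficit_nodes N f0) f0 f1 \<tau>1 \<and>
        projection_round A N (excess_nodes N f1) {source N} f1 f2 \<tau>2 \<and>
        projection_round A N {sink N} (deficit_nodes N f2) f2 f3 \<tau>3 \<and>
        ford_fulkerson A N f3 g \<tau>4 \<and>
        \<tau> = 1 + card (edges N) + \<tau>1 + \<tau>2 + \<tau>3 + \<tau>4)"

end

theory Submission
  imports Defs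
begin

text \<open>
  A set \<open>X\<close> of nodes is closed under residual arcs iff its net inflow is minus the capacity
  of the arcs leaving \<open>X\<close>, the least possible value. As augmentations change the net inflow at their
  end points only, this yields that no path is missing when a round stops: the first two rounds
  remove all excess and the third one all deficit.

  For the time bound, every augmentation moves at least one unit, so it suffices to bound the
  units moved. If \<open>f*\<close> is a maximum flow closest to the prediction, the net inflows of the clipped
  prediction and of \<open>f*\<close> differ by at most \<open>2 \<eta>\<close> in total. This bounds the units moved by each round of
  the projection, and also those moved by the last phase, because only the second round lowers
  the value of the flow, by what it moves.
\<close>

section \<open>Net inflow and residual cuts\<close>

text \<open>Excess and deficit are the positive and negative parts of this quantity. Unlike them it
  is linear in the flow, so it can be summed over node sets; integers avoid truncated
  subtraction.\<close>

definition net_inflow :: "network \<Rightarrow> flow \<Rightarrow> nat \<Rightarrow> int" where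
  "net_inflow N f u = int (inflow N f u) - int (outflow N f u)"

text \<open>The sum runs over all edges, with zero summands, so that it combines edge by edge with
  the formula for the net inflow of a set.\<close>

definition cut_capacity :: "network \<Rightarrow> nat set \<Rightarrow> int" where
  "cut_capacity N X = (\<Sum>e\<in>edges N. if fst e \<in> X \<and> snd e \<notin> X then int (capacity N e) else 0)"

text \<open>Parallel arcs are merged into a relation on nodes, so that reachability becomes a
  reflexive transitive closure. Arcs outside the network have residual capacity 0 and drop
  out.\<close>

definition residual_step :: "network \<Rightarrow> flow \<Rightarrow> (nat \<times> nat) set" where
  "residual_step N f = {(arc_tail a, arc_head a) | a. residual_capacity N f a > 0}"

lemma finite_nodes: "is_network N \<Longrightarrow> finite (nodes N)"
  and finite_edges: "is_network N \<Longrightarrow> finite (edges N)"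
  by (auto simp: is_network_def pair_fin_digraph.pair_finite_verts pair_fin_digraph.pair_finite_arcs)

lemma edge_nodes:
  assumes "is_network N" "e \<in> edges N"
  shows "fst e \<in> nodes N" "snd e \<in> nodes N"
proof -
  interpret pair_fin_digraph "net_graph N" using assms(1) by (simp add: is_network_def)
  show "fst e \<in> nodes N" "snd e \<in> nodes N"
    using assms(2) by (auto simp: arc_fst_in_verts arc_snd_in_verts)
qed

lemma inflow_source: "is_network N \<Longrightarrow> inflow N f (source N) = 0"
  and outflow_sink: "is_network N \<Longrightarrow> outflow N f (sink N) = 0"
  by (auto simp: is_network_def inflow_def outflow_def intro!: sum.neutral)

lemma net_inflow_source: "is_network N \<Longrightarrow> net_inflow N f (source N) = - int (flow_value N f)"
  by (simp add: net_inflow_def inflow_source flow_value_def)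

lemma excess_eq: "int (excess N f u) = max 0 (net_inflow N f u)"
  and deficit_eq: "int (deficit N f u) = max 0 (- net_inflow N f u)"
  by (auto simp: excess_def deficit_def net_inflow_def)

lemma net_inflow_cong:
  assumes "\<And>e. e \<in> edges N \<Longrightarrow> f e = g e"
  shows "net_inflow N f u = net_inflow N g u"
proof -
  have "inflow N f u = inflow N g u" "outflow N f u = outflow N g u"
    unfolding inflow_def outflow_def by (auto intro!: sum.cong assms)
  then show ?thesis by (simp add: net_inflow_def)
qed

lemma net_inflow_eq_sum:
  assumes "is_network N"
  shows "net_inflow N f u = (\<Sum>e\<in>edges N. int (f e) * (of_bool (snd e = u) - of_bool (fst e = u)))"
proof -
  have "net_inflow N f u = (\<Sum>e\<in>edges N. if snd e = u then int (f e) else 0)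
      - (\<Sum>e\<in>edges N. if fst e = u then int (f e) else 0)"
    using finite_edges[OF assms]
    by (simp add: net_inflow_def inflow_def outflow_def sum.inter_filter if_distrib cong: if_cong)
  also have "\<dots> = (\<Sum>e\<in>edges N. int (f e) * (of_bool (snd e = u) - of_bool (fst e = u)))"
    unfolding sum_subtractf[symmetric] by (intro sum.cong) auto
  finally show ?thesis .
qed

text \<open>An edge inside \<open>X\<close> is counted once with each sign and cancels; only edges
  crossing the boundary remain.\<close>

lemma sum_net_inflow:
  assumes "is_network N" "finite X"
  shows "(\<Sum>u\<in>X. net_inflow N f u)
    = (\<Sum>e\<in>edges N. int (f e) * (of_bool (snd e \<in> X) - of_bool (fst e \<in> X)))"
proof -
  have "(\<Sum>u\<in>X. of_bool (v = u) :: int) = of_bool (v \<in> X)" for v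
    using assms(2) by (simp add: of_bool_def)
  then have "(\<Sum>u\<in>X. int (f e) * (of_bool (snd e = u) - of_bool (fst e = u)))
      = int (f e) * (of_bool (snd e \<in> X) - of_bool (fst e \<in> X))" for e
    by (simp only: sum_distrib_left[symmetric] sum_subtractf)
  then show ?thesis
    unfolding net_inflow_eq_sum[OF assms(1)] by (subst sum.swap) simp
qed

lemma sum_net_inflow_nodes:
  assumes "is_network N"
  shows "(\<Sum>u\<in>nodes N. net_inflow N f u) = 0"
  using assms by (auto simp: sum_net_inflow finite_nodes edge_nodes intro!: sum.neutral)

text \<open>An edge leaving \<open>X\<close> contributes \<open>c - f\<close> and an edge entering
  it contributes \<open>f\<close>, which are the residual capacities of the arcs out of
  \<open>X\<close>. All summands are nonnegative, giving both the lower bound and its equality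
  case.\<close>

lemma sum_net_inflow_residual:
  assumes "is_network N" "within_capacity N f" "finite X"
  shows "(\<Sum>u\<in>X. net_inflow N f u) + cut_capacity N X
    = (\<Sum>e\<in>edges N. if fst e \<in> X \<and> snd e \<notin> X then int (residual_capacity N f (Fwd e))
         else if fst e \<notin> X \<and> snd e \<in> X then int (residual_capacity N f (Bwd e)) else 0)"
  unfolding sum_net_inflow[OF assms(1,3)] cut_capacity_def sum.distrib[symmetric]
  using assms(2) by (intro sum.cong) (auto simp: within_capacity_def of_nat_diff)

lemma sum_net_inflow_ge:
  assumes "is_network N" "within_capacity N f" "finite X"
  shows "- cut_capacity N X \<le> (\<Sum>u\<in>X. net_inflow N f u)"
proof -
  have "0 \<le> (\<Sum>u\<in>X. net_inflow N f u) + cut_capacity N X"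
    unfolding sum_net_inflow_residual[OF assms] by (intro sum_nonneg) auto
  then show ?thesis by linarith
qed

lemma residual_closed_iff:
  assumes "is_network N" "within_capacity N f" "finite X"
  shows "residual_step N f `` X \<subseteq> X \<longleftrightarrow> (\<Sum>u\<in>X. net_inflow N f u) = - cut_capacity N X"
proof -
  have "(\<Sum>u\<in>X. net_inflow N f u) = - cut_capacity N X \<longleftrightarrow>
      (\<Sum>u\<in>X. net_inflow N f u) + cut_capacity N X = 0"
    by linarith
  also have "\<dots> \<longleftrightarrow> (\<forall>e\<in>edges N.
      (fst e \<in> X \<and> snd e \<notin> X \<longrightarrow> residual_capacity N f (Fwd e) = 0) \<and>
      (fst e \<notin> X \<and> snd e \<in> X \<longrightarrow> residual_capacity N f (Bwd e) = 0))"
    unfolding sum_net_inflow_residual[OF assms]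
    by (subst sum_nonneg_eq_0_iff) (auto simp: finite_edges[OF assms(1)])
  also have "\<dots> \<longleftrightarrow> residual_step N f `` X \<subseteq> X"
  proof
    assume *: "\<forall>e\<in>edges N.
      (fst e \<in> X \<and> snd e \<notin> X \<longrightarrow> residual_capacity N f (Fwd e) = 0) \<and>
      (fst e \<notin> X \<and> snd e \<in> X \<longrightarrow> residual_capacity N f (Bwd e) = 0)"
    show "residual_step N f `` X \<subseteq> X"
    proof
      fix v assume "v \<in> residual_step N f `` X"
      then obtain a where a: "arc_tail a \<in> X" "v = arc_head a" "residual_capacity N f a > 0"
        by (auto simp: residual_step_def)
      with * show "v \<in> X" by (cases a) (auto split: if_splits)
    qed
  next
    assume *: "residual_step N f `` X \<subseteq> X"
    have "arc_head a \<in> X" if "arc_tail a \<in> X" "residual_capacity N f a > 0" for a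
      using * that by (auto simp: residual_step_def)
    from this[of "Fwd e" for e] this[of "Bwd e" for e]
    show "\<forall>e\<in>edges N.
      (fst e \<in> X \<and> snd e \<notin> X \<longrightarrow> residual_capacity N f (Fwd e) = 0) \<and>
      (fst e \<notin> X \<and> snd e \<in> X \<longrightarrow> residual_capacity N f (Bwd e) = 0)"
      by (metis arc_tail.simps arc_head.simps neq0_conv)
  qed
  finally show ?thesis by simp
qed

section \<open>Reachability in the residual graph\<close>

lemma residual_step_nodes:
  "is_network N \<Longrightarrow> residual_step N f \<subseteq> nodes N \<times> nodes N"
proof
  fix x assume N: "is_network N" and "x \<in> residual_step N f"
  then obtain a where "x = (arc_tail a, arc_head a)" "residual_capacity N f a > 0"
    by (auto simp: residual_step_def)
  with edge_nodes[OF N] show "x \<in> nodes N \<times> nodes N"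
    by (cases a) (auto split: if_splits)
qed

lemma residual_reach_nodes:
  assumes "is_network N" "X \<subseteq> nodes N"
  shows "(residual_step N f)\<^sup>* `` X \<subseteq> nodes N"
proof -
  have "(residual_step N f)\<^sup>* `` X \<subseteq> (residual_step N f)\<^sup>* `` nodes N"
    using assms(2) by blast
  also have "\<dots> = nodes N"
    using residual_step_nodes[OF assms(1)] by (intro Image_closed_trancl) blast
  finally show ?thesis .
qed

lemma residual_reach_closed:
  "residual_step N f `` ((residual_step N f)\<^sup>* `` X) \<subseteq> (residual_step N f)\<^sup>* `` X"
  by (auto intro: rtrancl_into_rtrancl)


section \<open>Augmentation\<close>

lemma residual_graph_simps:
  "verts (residual_graph N) = nodes N"
  "arcs (residual_graph N) = Fwd ` edges N \<union> Bwd ` edges N"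
  "tail (residual_graph N) = arc_tail"
  "head (residual_graph N) = arc_head"
  by (simp_all add: residual_graph_def)

lemma wf_residual_graph:
  assumes "is_network N"
  shows "wf_digraph (residual_graph N)"
  using edge_nodes[OF assms] by unfold_locales (auto simp: residual_graph_simps)

text \<open>A walk is built backwards from the sink. Cutting out its cycles keeps a subset of its
  arcs, so all residual capacities stay positive.\<close>

lemma augmenting_path_if_reachable:
  assumes N: "is_network N" and "(source N, sink N) \<in> (residual_step N f)\<^sup>*"
  shows "\<exists>p. augmenting_path N f p"
proof -
  interpret R: wf_digraph "residual_graph N" by (rule wf_residual_graph[OF N])
  have "\<exists>p. R.awalk (source N) p (sink N) \<and> (\<forall>a\<in>set p. residual_capacity N f a > 0)"
    using assms(2)
  proof (induction rule: converse_rtrancl_induct)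
    case base
    show ?case
      using N by (intro exI[of _ "[]"])
        (auto simp: R.awalk_Nil_iff residual_graph_simps is_network_def)
  next
    case (step y z)
    then obtain p a where p: "R.awalk z p (sink N)" "\<forall>a\<in>set p. residual_capacity N f a > 0"
      and a: "residual_capacity N f a > 0" "y = arc_tail a" "z = arc_head a"
      by (auto simp: residual_step_def)
    from a(1) have "a \<in> arcs (residual_graph N)"
      by (cases a) (auto simp: residual_graph_simps split: if_splits)
    with p a have "R.awalk y (a # p) (sink N)"
      by (auto simp: R.awalk_Cons_iff residual_graph_simps)
    with p a show ?case by (intro exI[of _ "a # p"]) auto
  qed
  then obtain p where "R.awalk (source N) p (sink N)" "\<forall>a\<in>set p. residual_capacity N f a > 0"
    by blast
  then have "augmenting_path N f (R.awalk_to_apath p)"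
    using R.apath_awalk_to_apath R.awalk_to_apath_subset
    unfolding augmenting_path_def by blast
  then show ?thesis ..
qed

text \<open>The sum telescopes: an inner visit of \<open>u\<close> enters and leaves it
  once.\<close>

lemma cas_sum_list:
  "pre_digraph.cas (residual_graph N) v p w \<Longrightarrow>
    (\<Sum>a\<leftarrow>p. of_bool (arc_head a = u) - of_bool (arc_tail a = u)) = (of_bool (w = u) - of_bool (v = u) :: int)"
  by (induction p arbitrary: v) (auto simp: pre_digraph.cas.simps residual_graph_simps)

text \<open>Using both directions of an edge would revisit the tail of the earlier arc. This matters
  because \<open>augment\<close> tests \<open>Fwd e\<close> first and would ignore a simultaneous
  \<open>Bwd e\<close>.\<close>

lemma apath_not_antiparallel:
  assumes "is_network N" "pre_digraph.apath (residual_graph N) v p w" "Fwd e \<in> set p"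
  shows "Bwd e \<notin> set p"
proof -
  interpret R: wf_digraph "residual_graph N" by (rule wf_residual_graph[OF assms(1)])
  show ?thesis
    using assms(2,3)
  proof (induction p arbitrary: v)
    case (Cons a p)
    have a: "R.awalk (head (residual_graph N) a) p w"
      "tail (residual_graph N) a \<notin> set (R.awalk_verts (head (residual_graph N) a) p)"
      using Cons.prems(1) unfolding R.apath_Cons_iff by (auto simp: R.apath_def)
    have no: "b \<notin> set p" if "arc_head b = arc_tail a" for b
      using R.awalk_verts_arc2[OF a(1)] a(2) that by (force simp: residual_graph_simps)
    show ?case
      using Cons no by (auto simp: R.apath_Cons_iff)
  qed simp
qed

text \<open>Only the effect on net inflows is recorded, not the edges used; this makes the amounts
  of successive augmentations additive.\<close>

definition sends :: "network \<Rightarrow> flow \<Rightarrow> nat \<Rightarrow> flow \<Rightarrow> bool" where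
  "sends N f M g \<longleftrightarrow> within_capacity N g \<and> (\<forall>u. net_inflow N g u
     = net_inflow N f u + int M * (of_bool (u = sink N) - of_bool (u = source N)))"

lemma sends_trans: "sends N f M g \<Longrightarrow> sends N g M' h \<Longrightarrow> sends N f (M + M') h"
  by (simp add: sends_def distrib_right)

lemma augment_sends:
  assumes N: "is_network N" and f: "within_capacity N f" and p: "augmenting_path N f p"
  obtains M where "M > 0" "sends N f M (augment N f p)"
proof -
  interpret R: wf_digraph "residual_graph N" by (rule wf_residual_graph[OF N])
  define M where "M = Min (residual_capacity N f ` set p)"
  have path: "R.apath (source N) p (sink N)" and pos: "\<forall>a\<in>set p. residual_capacity N f a > 0"
    using p by (auto simp: augmenting_path_def)
  \<comment> \<open>Source and sink differ, so the bottleneck is a minimum over a nonempty set of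
    positive numbers.\<close>
  have "p \<noteq> []"
    using path N by (auto simp: R.apath_Nil_iff is_network_def)
  then have "M > 0"
    using pos by (simp add: M_def)
  have M_le: "M \<le> residual_capacity N f a" if "a \<in> set p" for a
    using that by (simp add: M_def)
  have arcs: "set p \<subseteq> Fwd ` edges N \<union> Bwd ` edges N"
    using path by (auto simp: R.apath_def R.awalk_def residual_graph_simps)
  have distinct: "distinct p"
    using path R.distinct_verts_imp_distinct by (auto simp: R.apath_def)
  have aug: "int (augment N f p e)
      = int (f e) + int M * (of_bool (Fwd e \<in> set p) - of_bool (Bwd e \<in> set p))"
    if "e \<in> edges N" for e
    using apath_not_antiparallel[OF N path, of e] M_le[of "Bwd e"] that
    by (auto simp: augment_def M_def[symmetric] of_nat_diff)
  have "augment N f p e \<le> capacity N e" if "e \<in> edges N" for e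
    using that f M_le[of "Fwd e"]
    by (auto simp: augment_def M_def[symmetric] within_capacity_def intro: diff_le_self[THEN le_trans])
  then have "within_capacity N (augment N f p)"
    by (simp add: within_capacity_def)
  moreover have "net_inflow N (augment N f p) u
     = net_inflow N f u + int M * (of_bool (u = sink N) - of_bool (u = source N))" for u
  proof -
    define \<delta> :: "arc \<Rightarrow> int" where "\<delta> a = of_bool (arc_head a = u) - of_bool (arc_tail a = u)" for a
    have fin: "finite (edges N)" by (rule finite_edges[OF N])
    have "of_bool (u = sink N) - of_bool (u = source N) = (\<Sum>a\<leftarrow>p. \<delta> a)"
      using path cas_sum_list[of N "source N" p "sink N" u]
      by (simp add: R.apath_def R.awalk_def \<delta>_def eq_commute)
    also have "\<dots> = (\<Sum>a\<in>set p. \<delta> a)"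
      using distinct by (rule sum_list_distinct_conv_sum_set)
    \<comment> \<open>The sum over the path is extended by zeros to all residual arcs, so that it
      splits by direction and can be reindexed by edges, where the change of the flow is
      known.\<close>
    also have "\<dots> = (\<Sum>a\<in>Fwd ` edges N \<union> Bwd ` edges N. of_bool (a \<in> set p) * \<delta> a)"
      using arcs fin by (intro sum.mono_neutral_cong_left) auto
    also have "\<dots> = (\<Sum>a\<in>Fwd ` edges N. of_bool (a \<in> set p) * \<delta> a)
        + (\<Sum>a\<in>Bwd ` edges N. of_bool (a \<in> set p) * \<delta> a)"
      using fin by (intro sum.union_disjoint) auto
    also have "\<dots> = (\<Sum>e\<in>edges N. of_bool (Fwd e \<in> set p) * \<delta> (Fwd e))
        + (\<Sum>e\<in>edges N. of_bool (Bwd e \<in> set p) * \<delta> (Bwd e))"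
      by (subst (1 2) sum.reindex) (auto simp: inj_on_def comp_def)
    finally have ends: "(\<Sum>e\<in>edges N. of_bool (Fwd e \<in> set p) * \<delta> (Fwd e)
        + of_bool (Bwd e \<in> set p) * \<delta> (Bwd e)) = of_bool (u = sink N) - of_bool (u = source N)"
      by (simp add: sum.distrib)
    have "net_inflow N (augment N f p) u = (\<Sum>e\<in>edges N.
        int (f e) * (of_bool (snd e = u) - of_bool (fst e = u))
        + int M * (of_bool (Fwd e \<in> set p) * \<delta> (Fwd e) + of_bool (Bwd e \<in> set p) * \<delta> (Bwd e)))"
      unfolding net_inflow_eq_sum[OF N]
      by (intro sum.cong) (auto simp: aug \<delta>_def algebra_simps)
    also have "\<dots> = net_inflow N f u + int M * (\<Sum>e\<in>edges N.
        of_bool (Fwd e \<in> set p) * \<delta> (Fwd e) + of_bool (Bwd e \<in> set p) * \<delta> (Bwd e))"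
      unfolding net_inflow_eq_sum[OF N] by (simp only: sum.distrib sum_distrib_left distrib_left)
    finally show ?thesis unfolding ends .
  qed
  ultimately have "sends N f M (augment N f p)"
    by (simp add: sends_def)
  with \<open>M > 0\<close> show ?thesis using that by blast
qed

text \<open>A simple path repeats no arc, and each edge has two residual arcs.\<close>

lemma length_augmenting_path:
  assumes N: "is_network N" and p: "augmenting_path N f p"
  shows "length p \<le> 2 * card (edges N)"
proof -
  interpret R: wf_digraph "residual_graph N" by (rule wf_residual_graph[OF N])
  have path: "R.apath (source N) p (sink N)"
    using p by (auto simp: augmenting_path_def)
  have fin: "finite (edges N)" by (rule finite_edges[OF N])
  have "length p = card (set p)"
    using path R.distinct_verts_imp_distinct by (auto simp: R.apath_def distinct_card)
  also have "\<dots> \<le> card (Fwd ` edges N \<union> Bwd ` edges N)"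
    using path fin by (intro card_mono) (auto simp: R.apath_def R.awalk_def residual_graph_simps)
  also have "\<dots> \<le> card (edges N) + card (edges N)"
    by (intro order.trans[OF card_Un_le] add_mono card_image_le fin)
  finally show ?thesis by simp
qed

text \<open>Every path carries at least one unit, so the number of paths is bounded by the amount
  sent.\<close>

lemma augment_list_sends:
  assumes N: "is_network N"
  shows "within_capacity N f \<Longrightarrow> augmenting_paths N f ps \<Longrightarrow>
    (\<exists>M\<ge>length ps. sends N f M (augment_list N f ps)) \<and>
    (\<Sum>p\<leftarrow>ps. length p) \<le> 2 * card (edges N) * length ps"
proof (induction ps arbitrary: f)
  case Nil
  then show ?case by (auto simp: sends_def intro: exI[of _ 0])
next
  case (Cons p ps)
  obtain M where M: "M > 0" "sends N f M (augment N f p)"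
    using Cons.prems augment_sends[OF N] by auto
  then obtain M' where M': "M' \<ge> length ps" "sends N (augment N f p) M' (augment_list N (augment N f p) ps)"
    and len: "(\<Sum>p\<leftarrow>ps. length p) \<le> 2 * card (edges N) * length ps"
    using Cons.IH[of "augment N f p"] Cons.prems by (auto simp: sends_def)
  have "sends N f (M + M') (augment_list N f (p # ps))"
    using sends_trans M(2) M'(2) by simp
  moreover have "M + M' \<ge> length (p # ps)" using M(1) M'(1) by simp
  moreover have "length p \<le> 2 * card (edges N)"
    using Cons.prems(2) length_augmenting_path[OF N, of f p] by simp
  ultimately show ?case
    using len by (auto simp: add_mono)
qed


section \<open>Ford--Fulkerson\<close>

text \<open>Fixes the constant hidden in \<open>augmenting_subroutine\<close>, so that later bounds
  can name it.\<close>

locale priced_subroutine =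
  fixes A :: subroutine and K :: nat
  assumes subroutine: "is_network N \<Longrightarrow> within_capacity N f \<Longrightarrow> A (residual_network N f) = (ps, \<tau>) \<Longrightarrow>
    augmenting_paths N f ps \<and> (ps = [] \<longleftrightarrow> (\<nexists>p. augmenting_path N f p)) \<and>
    \<tau> \<le> K * max 1 (card (edges N)) * max 1 (length ps)"
begin

text \<open>The cost is charged to the units sent: \<open>k\<close> paths cost
  \<open>K * m * k\<close> to find and at most \<open>2 * m * k\<close> to apply, and they send at
  least \<open>k\<close> units. The extra 1 in \<open>M + 1\<close> pays for the final call that
  finds nothing.\<close>

lemma ff_loop_sends:
  assumes N: "is_network N"
  shows "ff_loop A N f g \<tau> \<Longrightarrow> within_capacity N f \<Longrightarrow>
    \<exists>M. sends N f M g \<and> (\<nexists>p. augmenting_path N g p) \<and>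
      \<tau> \<le> (K + 2) * max 1 (card (edges N)) * (M + 1)"
proof (induction rule: ff_loop.induct)
  case (stop f \<tau>)
  have "\<tau> \<le> K * max 1 (card (edges N))" and "\<nexists>p. augmenting_path N f p"
    using subroutine[OF N stop(2,1)] by auto
  then show ?case
    using stop by (intro exI[of _ 0]) (auto simp: sends_def)
next
  case (step f ps \<tau> g \<tau>')
  define m where "m = max 1 (card (edges N))"
  have "\<tau> \<le> K * m * length ps" and paths: "augmenting_paths N f ps"
    using subroutine[OF N step(5,1)] step(2) by (auto simp: m_def max_def Suc_le_eq)
  moreover obtain M where M: "M \<ge> length ps" "sends N f M (augment_list N f ps)"
    and len: "(\<Sum>p\<leftarrow>ps. length p) \<le> 2 * card (edges N) * length ps"
    using augment_list_sends[OF N step(5) paths] by blast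
  moreover have "2 * card (edges N) * length ps \<le> 2 * m * length ps"
    by (intro mult_right_mono) (auto simp: m_def)
  ultimately have "\<tau> + (\<Sum>p\<leftarrow>ps. length p) \<le> K * m * length ps + 2 * m * length ps"
    by linarith
  also have "\<dots> = (K + 2) * m * length ps"
    by (simp add: algebra_simps)
  also have "\<dots> \<le> (K + 2) * m * M"
    using M(1) by (rule mult_left_mono) simp
  finally have 1: "\<tau> + (\<Sum>p\<leftarrow>ps. length p) \<le> (K + 2) * m * M" .
  obtain M' where M': "sends N (augment_list N f ps) M' g" "\<nexists>p. augmenting_path N g p"
    "\<tau>' \<le> (K + 2) * m * (M' + 1)"
    using step.IH M(2) by (auto simp: sends_def m_def)
  have "\<tau> + (\<Sum>p\<leftarrow>ps. length p) + \<tau>' \<le> (K + 2) * m * (M + M' + 1)"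
    using add_mono[OF 1 M'(3)] by (simp only: distrib_left add.assoc)
  then show ?case
    using M'(2) sends_trans[OF M(2) M'(1)] by (auto simp: m_def)
qed

lemma ff_loop_exists:
  assumes N: "is_network N"
  shows "within_capacity N f \<Longrightarrow> \<exists>g \<tau>. ff_loop A N f g \<tau>"
\<comment> \<open>The measure is the residual capacity out of the source. Its integer value is never
  negative and drops by the amount sent in every iteration that returns a path.\<close>
proof (induction "nat (net_inflow N f (source N) + cut_capacity N {source N})"
    arbitrary: f rule: less_induct)
  case less
  obtain ps \<tau> where run: "A (residual_network N f) = (ps, \<tau>)" by fastforce
  show ?case
  proof (cases "ps = []")
    case True
    then show ?thesis using run by (auto intro: ff_loop.stop)
  next
    case False
    have "augmenting_paths N f ps" using subroutine[OF N less.prems run] by simp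
    then obtain M where M: "M \<ge> length ps" "sends N f M (augment_list N f ps)"
      using augment_list_sends[OF N less.prems] by blast
    let ?f = "augment_list N f ps"
    have w: "within_capacity N ?f" using M(2) by (simp add: sends_def)
    have "net_inflow N ?f (source N) = net_inflow N f (source N) - int M"
      using M(2) N by (simp add: sends_def is_network_def)
    moreover have "M > 0" using False M(1) by (cases ps) auto
    moreover have "- cut_capacity N {source N} \<le> net_inflow N ?f (source N)"
      using sum_net_inflow_ge[OF N w, of "{source N}"] by simp
    ultimately have "\<exists>g \<tau>. ff_loop A N ?f g \<tau>"
      using w by (intro less.hyps) auto
    then show ?thesis using ff_loop.step[of A N, OF run False] by blast
  qed
qed

lemma ford_fulkerson_exists:
  "is_network N \<Longrightarrow> within_capacity N f \<Longrightarrow> \<exists>g \<tau>. ford_fulkerson A N f g \<tau>"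
  using ff_loop_exists by (force simp: ford_fulkerson_def)

lemma ford_fulkerson_sends:
  assumes N: "is_network N" and f: "within_capacity N f" and run: "ford_fulkerson A N f g \<tau>"
  obtains M where "sends N f M g" "(source N, sink N) \<notin> (residual_step N g)\<^sup>*"
    "\<tau> \<le> (K + 4) * max 1 (card (edges N)) * (M + 1)"
proof -
  obtain \<tau>' where loop: "ff_loop A N f g \<tau>'" and \<tau>: "\<tau> = 1 + card (edges N) + \<tau>'"
    using run by (auto simp: ford_fulkerson_def)
  obtain M where M: "sends N f M g" "\<nexists>p. augmenting_path N g p"
    "\<tau>' \<le> (K + 2) * max 1 (card (edges N)) * (M + 1)"
    using ff_loop_sends[OF N loop f] by blast
  have "1 + card (edges N) \<le> 2 * max 1 (card (edges N)) * 1" by simp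
  also have "\<dots> \<le> 2 * max 1 (card (edges N)) * (M + 1)" by (intro mult_left_mono) auto
  finally have "\<tau> \<le> 2 * max 1 (card (edges N)) * (M + 1) + (K + 2) * max 1 (card (edges N)) * (M + 1)"
    unfolding \<tau> by (rule add_mono[OF _ M(3)])
  also have "\<dots> = (K + 4) * max 1 (card (edges N)) * (M + 1)"
    by (simp add: algebra_simps)
  finally show ?thesis
    using that M augmenting_path_if_reachable[OF N] by blast
qed

end

section \<open>Optimality from a saturated cut\<close>

lemma max_flow_if_sink_unreachable:
  assumes N: "is_network N" and f: "feasible N f"
    and "(source N, sink N) \<notin> (residual_step N f)\<^sup>*"
  shows "max_flow N f"
proof -
  define X where "X = (residual_step N f)\<^sup>* `` {source N}"
  have s: "source N \<in> X" and t: "sink N \<notin> X"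
    using assms(3) by (auto simp: X_def)
  have X: "X \<subseteq> nodes N"
    unfolding X_def using N by (intro residual_reach_nodes) (auto simp: is_network_def)
  have fin: "finite X" using X finite_nodes[OF N] finite_subset by blast
  \<comment> \<open>\<open>X\<close> contains the source but not the sink, so by conservation its
    net inflow is minus the value of any feasible flow. The lower bound on net inflows then becomes
    weak duality, with equality for \<open>f\<close> since \<open>X\<close> is closed.\<close>
  have cut_value: "(\<Sum>u\<in>X. net_inflow N g u) = - int (flow_value N g)" if "feasible N g" for g
  proof -
    have "(\<Sum>u\<in>X. net_inflow N g u) = (\<Sum>u\<in>{source N}. net_inflow N g u)"
      using that s t X fin
      by (intro sum.mono_neutral_right) (auto simp: feasible_def net_inflow_def subset_iff)
    then show ?thesis by (simp add: net_inflow_source[OF N])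
  qed
  have "residual_step N f `` X \<subseteq> X"
    unfolding X_def by (rule residual_reach_closed)
  then have "int (flow_value N f) = cut_capacity N X"
    using residual_closed_iff[OF N _ fin, of f] f cut_value[OF f] by (simp add: feasible_def)
  moreover have "int (flow_value N g) \<le> cut_capacity N X" if "feasible N g" for g
    using sum_net_inflow_ge[OF N _ fin, of g] that cut_value[OF that] by (simp add: feasible_def)
  ultimately show ?thesis
    using f by (auto simp: max_flow_def) (metis of_nat_le_iff)
qed


section \<open>The projection\<close>

lemma super_notin_nodes:
  assumes "is_network N"
  shows "super_source N \<notin> nodes N" "super_sink N \<notin> nodes N" "super_source N \<noteq> super_sink N"
  using Max_ge[OF finite_nodes[OF assms]] by (force simp: super_source_def super_sink_def)+

lemma aux_network_simps:
  "nodes (aux_network N f S D) = nodes N \<union> {super_source N, super_sink N}"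
  "edges (aux_network N f S D) = edges N \<union> {super_source N} \<times> S \<union> D \<times> {super_sink N}"
  "source (aux_network N f S D) = super_source N"
  "sink (aux_network N f S D) = super_sink N"
  by (simp_all add: aux_network_def)

lemma card_edges_aux_network:
  assumes "card S \<le> max 1 (card (edges N))" "card D \<le> max 1 (card (edges N))"
  shows "card (edges (aux_network N f S D)) \<le> 3 * max 1 (card (edges N))"
proof -
  have "card (edges (aux_network N f S D))
      \<le> card (edges N) + card ({super_source N} \<times> S) + card (D \<times> {super_sink N})"
    unfolding aux_network_simps
    by (intro order.trans[OF card_Un_le] add_mono card_Un_le order.refl)
  also have "\<dots> = card (edges N) + card S + card D"
    by (simp add: card_cartesian_product)
  finally show ?thesis using assms by linarith
qed

lemma net_inflow_restrict_flow: "net_inflow N (restrict_flow N h) u = net_inflow N h u"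
  by (rule net_inflow_cong) (simp add: restrict_flow_def)

text \<open>\<open>S\<close> and \<open>D\<close> stay arbitrary so that one analysis serves all
  three rounds.\<close>

locale auxiliary_network =
  fixes N :: network and f :: flow and S D :: "nat set"
  assumes network: "is_network N" and capacities: "within_capacity N f"
    and starts: "S \<subseteq> nodes N" and ends: "D \<subseteq> nodes N"
begin

abbreviation "aux \<equiv> aux_network N f S D"

lemma finite_starts: "finite S" and finite_ends: "finite D"
  using starts ends finite_nodes[OF network] by (auto intro: finite_subset)

lemma edge_super: "(u, v) \<in> edges N \<Longrightarrow> u \<in> nodes N \<and> v \<in> nodes N"
  using edge_nodes[OF network] by force

lemma super_simps [simp]: "super_source N \<notin> nodes N" "super_sink N \<notin> nodes N"
  "super_source N \<notin> S" "super_sink N \<notin> S" "super_source N \<notin> D" "super_sink N \<notin> D"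
  "super_source N \<noteq> super_sink N" "super_sink N \<noteq> super_source N"
  "(super_source N, v) \<notin> edges N" "(v, super_source N) \<notin> edges N"
  "(super_sink N, v) \<notin> edges N" "(v, super_sink N) \<notin> edges N"
  using super_notin_nodes[OF network] starts ends edge_super by auto

lemma is_network_aux: "is_network aux"
proof -
  have "pair_fin_digraph (net_graph aux)"
  proof
    fix e assume e: "e \<in> edges aux"
    show "fst e \<in> nodes aux" "snd e \<in> nodes aux"
      using e starts ends edge_super by (cases e; auto simp: aux_network_simps)+
  next
    show "finite (nodes aux)" "finite (edges aux)"
      using finite_nodes[OF network] finite_edges[OF network] finite_starts finite_ends
      by (auto simp: aux_network_simps)
  qed
  then show ?thesis
    unfolding is_network_def by (auto simp: aux_network_simps)
qed

lemma capacity_aux: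
  "e \<in> edges N \<Longrightarrow> capacity aux e = capacity N e"
  "capacity aux (super_source N, v) = excess N f v"
  "v \<noteq> super_source N \<Longrightarrow> capacity aux (v, super_sink N) = deficit N f v"
  by (cases e) (auto simp: aux_network_def)

lemma within_capacity_aux: "within_capacity aux (restrict_flow N f)"
  using capacities
  by (auto simp: within_capacity_def restrict_flow_def capacity_aux aux_network_simps)

text \<open>The flow on the super arc into \<open>u\<close>. The default 0 off \<open>S\<close> lets
  the net inflow formula hold uniformly at all nodes of \<open>N\<close>.\<close>

definition sent_from :: "flow \<Rightarrow> nat \<Rightarrow> nat" where
  "sent_from h u = (if u \<in> S then h (super_source N, u) else 0)"

definition sent_to :: "flow \<Rightarrow> nat \<Rightarrow> nat" where
  "sent_to h v = (if v \<in> D then h (v, super_sink N) else 0)"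

lemma net_inflow_aux:
  assumes "u \<in> nodes N"
  shows "net_inflow aux h u = net_inflow N h u + int (sent_from h u) - int (sent_to h u)"
proof -
  have u: "u \<noteq> super_source N" "u \<noteq> super_sink N" using assms by auto
  have "{e \<in> edges aux. snd e = u}
      = {e \<in> edges N. snd e = u} \<union> (if u \<in> S then {(super_source N, u)} else {})"
    using u by (auto simp: aux_network_simps)
  then have "inflow aux h u = inflow N h u + sent_from h u"
    by (simp add: inflow_def sent_from_def finite_edges[OF network])
  moreover have "{e \<in> edges aux. fst e = u}
      = {e \<in> edges N. fst e = u} \<union> (if u \<in> D then {(u, super_sink N)} else {})"
    using u by (auto simp: aux_network_simps)
  then have "outflow aux h u = outflow N h u + sent_to h u"
    by (simp add: outflow_def sent_to_def finite_edges[OF network])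
  ultimately show ?thesis by (simp add: net_inflow_def)
qed

lemma net_inflow_super_source: "net_inflow aux h (super_source N) = - int (\<Sum>u\<in>S. sent_from h u)"
proof -
  have "{e \<in> edges aux. fst e = super_source N} = Pair (super_source N) ` S"
    by (auto simp: aux_network_simps)
  then have "outflow aux h (super_source N) = (\<Sum>u\<in>S. sent_from h u)"
    by (simp add: outflow_def sent_from_def sum.reindex inj_on_def)
  then show ?thesis
    using inflow_source[OF is_network_aux] by (simp add: net_inflow_def aux_network_simps)
qed

lemma net_inflow_super_sink: "net_inflow aux h (super_sink N) = int (\<Sum>v\<in>D. sent_to h v)"
proof -
  have "{e \<in> edges aux. snd e = super_sink N} = (\<lambda>v. (v, super_sink N)) ` D"
    by (auto simp: aux_network_simps)
  then have "inflow aux h (super_sink N) = (\<Sum>v\<in>D. sent_to h v)"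
    by (simp add: inflow_def sent_to_def sum.reindex inj_on_def)
  then show ?thesis
    using outflow_sink[OF is_network_aux] by (simp add: net_inflow_def aux_network_simps)
qed

text \<open>The original edges keep their capacities, so every projection path in \<open>N\<close>
  is available in the auxiliary network.\<close>

lemma residual_step_aux:
  "residual_step N (restrict_flow N h) \<subseteq> residual_step aux h"
proof
  fix x assume "x \<in> residual_step N (restrict_flow N h)"
  then obtain a where a: "x = (arc_tail a, arc_head a)"
    "residual_capacity N (restrict_flow N h) a > 0"
    by (auto simp: residual_step_def)
  from a(2) have "residual_capacity aux h a > 0"
    by (cases a) (auto simp: restrict_flow_def capacity_aux aux_network_simps split: if_splits)
  with a(1) show "x \<in> residual_step aux h"
    by (auto simp: residual_step_def)
qed

text \<open>Unsaturated super arcs at \<open>u\<close> and \<open>v\<close> extend a residual path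
  between them to one joining the super terminals. Read contrapositively, a finished round has no
  projection path left.\<close>

lemma reachable_aux:
  assumes "u \<in> S" "sent_from h u < excess N f u" "v \<in> D" "sent_to h v < deficit N f v"
    and "(u, v) \<in> (residual_step N (restrict_flow N h))\<^sup>*"
  shows "(source aux, sink aux) \<in> (residual_step aux h)\<^sup>*"
proof -
  have "v \<noteq> super_source N" using assms(3) by auto
  then have "residual_capacity aux h (Fwd (super_source N, u)) > 0"
    "residual_capacity aux h (Fwd (v, super_sink N)) > 0"
    using assms(1-4)
    by (auto simp: aux_network_simps capacity_aux sent_from_def sent_to_def)
  then have "(super_source N, u) \<in> residual_step aux h \<and> (v, super_sink N) \<in> residual_step aux h"
    unfolding residual_step_def by (metis (mono_tags, lifting) arc_head.simps(1) arc_tail.simps(1)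
      fst_conv mem_Collect_eq snd_conv)
  moreover have "(u, v) \<in> (residual_step aux h)\<^sup>*"
    using assms(5) rtrancl_mono[OF residual_step_aux] by blast
  ultimately show ?thesis
    by (simp add: aux_network_simps) (meson converse_rtrancl_into_rtrancl rtrancl.rtrancl_into_rtrancl)
qed

end

section \<open>Outcome and cost of a single projection round\<close>

text \<open>\<open>a u\<close> and \<open>b v\<close> are the units that start at \<open>u\<close> and end at \<open>v\<close>, and \<open>M\<close> is their
  total; the last conjunct says that the round cannot be continued.\<close>

definition round_outcome ::
  "network \<Rightarrow> nat set \<Rightarrow> nat set \<Rightarrow> flow \<Rightarrow> flow \<Rightarrow> (nat \<Rightarrow> nat) \<Rightarrow> (nat \<Rightarrow> nat) \<Rightarrow> nat \<Rightarrow> bool" where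
  "round_outcome N S D f g a b M \<longleftrightarrow> within_capacity N g \<and>
     (\<forall>u. a u \<le> (if u \<in> S then excess N f u else 0)) \<and>
     (\<forall>v. b v \<le> (if v \<in> D then deficit N f v else 0)) \<and>
     (\<forall>u\<in>nodes N. net_inflow N g u = net_inflow N f u - int (a u) + int (b u)) \<and>
     (\<Sum>u\<in>S. a u) = M \<and> (\<Sum>v\<in>D. b v) = M \<and>
     (\<forall>u\<in>S. \<forall>v\<in>D. a u < excess N f u \<longrightarrow> b v < deficit N f v \<longrightarrow>
        (u, v) \<notin> (residual_step N g)\<^sup>*)"

context priced_subroutine
begin

lemma projection_round_exists:
  assumes "is_network N" "within_capacity N f" "S \<subseteq> nodes N" "D \<subseteq> nodes N"
  shows "\<exists>g \<tau>. projection_round A N S D f g \<tau>"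
proof -
  interpret auxiliary_network N f S D using assms by unfold_locales
  show ?thesis
    using ford_fulkerson_exists[OF is_network_aux within_capacity_aux]
    by (auto simp: projection_round_def)
qed

text \<open>The witnesses are the final flows on the super arcs, and \<open>M\<close> is the amount
  sent between the super terminals. The factor 3 comes from the edge count of the auxiliary
  network.\<close>

lemma projection_round_outcome:
  assumes "is_network N" "within_capacity N f" "S \<subseteq> nodes N" "D \<subseteq> nodes N"
    and card: "card S \<le> max 1 (card (edges N))" "card D \<le> max 1 (card (edges N))"
    and run: "projection_round A N S D f g \<tau>"
  obtains a b M where "round_outcome N S D f g a b M"
    "\<tau> \<le> 3 * (K + 4) * max 1 (card (edges N)) * (M + 1)"
proof -
  interpret auxiliary_network N f S D using assms by unfold_locales
  obtain h where h: "ford_fulkerson A aux (restrict_flow N f) h \<tau>" and g: "g = restrict_flow N h"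
    using run by (auto simp: projection_round_def)
  obtain M where M: "sends aux (restrict_flow N f) M h"
    "(source aux, sink aux) \<notin> (residual_step aux h)\<^sup>*"
    "\<tau> \<le> (K + 4) * max 1 (card (edges aux)) * (M + 1)"
    using ford_fulkerson_sends[OF is_network_aux within_capacity_aux h] by blast
  have cap: "within_capacity aux h"
    and net: "net_inflow aux h u = net_inflow aux (restrict_flow N f) u
      + int M * (of_bool (u = super_sink N) - of_bool (u = super_source N))" for u
    using M(1) by (auto simp: sends_def aux_network_simps)
  have cap_edge: "h e \<le> capacity aux e" if "e \<in> edges aux" for e
    using cap that by (simp add: within_capacity_def)
  \<comment> \<open>The super arcs start empty, so their final flow is exactly what the round
    moved.\<close>
  have zero: "sent_from (restrict_flow N f) u = 0" "sent_to (restrict_flow N f) u = 0" for u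
    by (auto simp: sent_from_def sent_to_def restrict_flow_def)
  have "within_capacity N g"
    unfolding within_capacity_def
  proof
    fix e assume e: "e \<in> edges N"
    then have "h e \<le> capacity aux e"
      using cap_edge by (simp add: aux_network_simps)
    with e show "g e \<le> capacity N e"
      by (simp add: g restrict_flow_def capacity_aux)
  qed
  moreover have "sent_from h u \<le> (if u \<in> S then excess N f u else 0)" for u
    using cap_edge[of "(super_source N, u)"]
    by (simp add: sent_from_def capacity_aux aux_network_simps)
  moreover have "sent_to h v \<le> (if v \<in> D then deficit N f v else 0)" for v
    using cap_edge[of "(v, super_sink N)"]
    by (cases "v = super_source N") (simp_all add: sent_to_def capacity_aux aux_network_simps)
  moreover have "net_inflow N g u = net_inflow N f u - int (sent_from h u) + int (sent_to h u)"
    if u: "u \<in> nodes N" for u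
  proof -
    have "u \<noteq> super_source N" "u \<noteq> super_sink N" using u by auto
    then show ?thesis
      using net[of u] by (simp add: g net_inflow_restrict_flow net_inflow_aux[OF u] zero)
  qed
  moreover have "(\<Sum>u\<in>S. sent_from h u) = M"
    using net[of "super_source N"] unfolding net_inflow_super_source by (simp add: zero flip: of_nat_sum)
  moreover have "(\<Sum>v\<in>D. sent_to h v) = M"
    using net[of "super_sink N"] unfolding net_inflow_super_sink by (simp add: zero flip: of_nat_sum)
  moreover have "(u, v) \<notin> (residual_step N g)\<^sup>*"
    if "u \<in> S" "v \<in> D" "sent_from h u < excess N f u" "sent_to h v < deficit N f v" for u v
    using that reachable_aux M(2) unfolding g by blast
  ultimately have "round_outcome N S D f g (sent_from h) (sent_to h) M"
    by (simp add: round_outcome_def)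
  moreover have "(K + 4) * max 1 (card (edges aux)) * (M + 1)
      \<le> (K + 4) * (3 * max 1 (card (edges N))) * (M + 1)"
    using card_edges_aux_network[OF card, of f] by (intro mult_le_mono) auto
  then have "(K + 4) * max 1 (card (edges aux)) * (M + 1)
      \<le> 3 * (K + 4) * max 1 (card (edges N)) * (M + 1)"
    by (simp only: mult_ac)
  then have "\<tau> \<le> 3 * (K + 4) * max 1 (card (edges N)) * (M + 1)"
    by (rule order.trans[OF M(3)])
  ultimately show ?thesis using that by blast
qed

text \<open>The round is itself a Ford-Fulkerson run on a network of this size, hence a member of
  the set whose supremum is taken.\<close>

lemma projection_round_time:
  assumes "is_network N" "within_capacity N f" "S \<subseteq> nodes N" "D \<subseteq> nodes N"
    and card: "card S \<le> max 1 (card (edges N))" "card D \<le> max 1 (card (edges N))"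
    and run: "projection_round A N S D f g \<tau>"
  shows "enat \<tau> \<le> ff_worst_time A (card (nodes N) + 2) (3 * max 1 (card (edges N)))"
proof -
  interpret auxiliary_network N f S D using assms by unfold_locales
  have "card (nodes aux) \<le> card (nodes N) + card {super_source N, super_sink N}"
    unfolding aux_network_simps by (rule card_Un_le)
  then have "card (nodes aux) \<le> card (nodes N) + 2" by simp
  moreover obtain h where "ford_fulkerson A aux (restrict_flow N f) h \<tau>"
    using run by (auto simp: projection_round_def)
  ultimately show ?thesis
    unfolding ff_worst_time_def
    using is_network_aux within_capacity_aux card_edges_aux_network[OF card]
    by (intro SUP_upper) blast
qed

end

text \<open>Each excess node is the head, and each deficit node the tail, of some edge. This keeps
  the number of super arcs linear in the number of edges.\<close>

lemma card_excess_nodes: "is_network N \<Longrightarrow> card (excess_nodes N f) \<le> card (edges N)"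
  and card_deficit_nodes: "is_network N \<Longrightarrow> card (deficit_nodes N f) \<le> card (edges N)"
proof -
  assume N: "is_network N"
  have "excess_nodes N f \<subseteq> snd ` edges N"
  proof
    fix u assume "u \<in> excess_nodes N f"
    then have "inflow N f u \<noteq> 0" by (auto simp: excess_nodes_def excess_def)
    then have "{e \<in> edges N. snd e = u} \<noteq> {}" unfolding inflow_def by (metis sum.empty)
    then show "u \<in> snd ` edges N" by blast
  qed
  then show "card (excess_nodes N f) \<le> card (edges N)"
    using finite_edges[OF N] by (rule surj_card_le[rotated])
  have "deficit_nodes N f \<subseteq> fst ` edges N"
  proof
    fix u assume "u \<in> deficit_nodes N f"
    then have "outflow N f u \<noteq> 0" by (auto simp: deficit_nodes_def deficit_def)
    then have "{e \<in> edges N. fst e = u} \<noteq> {}" unfolding outflow_def by (metis sum.empty)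
    then show "u \<in> fst ` edges N" by blast
  qed
  then show "card (deficit_nodes N f) \<le> card (edges N)"
    using finite_edges[OF N] by (rule surj_card_le[rotated])
qed

lemma excess_nodes_subset: "excess_nodes N f \<subseteq> nodes N - {source N, sink N}"
  and deficit_nodes_subset: "deficit_nodes N f \<subseteq> nodes N - {source N, sink N}"
  by (auto simp: excess_nodes_def deficit_nodes_def)

lemma within_capacity_clip: "within_capacity N (clip N f)"
  by (simp add: within_capacity_def clip_def)

section \<open>How a round changes excess and deficit\<close>

lemma round_outcome_amounts:
  assumes "round_outcome N S D f g a b M"
  shows "a u \<le> excess N f u" "b u \<le> deficit N f u" "u \<notin> S \<Longrightarrow> a u = 0" "u \<notin> D \<Longrightarrow> b u = 0"
proof -
  have "a u \<le> (if u \<in> S then excess N f u else 0)" "b u \<le> (if u \<in> D then deficit N f u else 0)"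
    using assms by (simp_all add: round_outcome_def)
  then show "a u \<le> excess N f u" "b u \<le> deficit N f u" "u \<notin> S \<Longrightarrow> a u = 0" "u \<notin> D \<Longrightarrow> b u = 0"
    by (simp_all split: if_splits)
qed

text \<open>The amounts are capped by excess and deficit, one of which is 0, so the net inflow moves
  towards 0 without changing sign. Hence a round never creates excess or deficit.\<close>

lemma round_outcome_imbalance:
  assumes "round_outcome N S D f g a b M" "u \<in> nodes N"
  shows "excess N f u = excess N g u + a u" "deficit N f u = deficit N g u + b u"
proof -
  have "a u \<le> excess N f u" "b u \<le> deficit N f u"
    using round_outcome_amounts[OF assms(1)] by auto
  moreover have "net_inflow N g u = net_inflow N f u - int (a u) + int (b u)"
    using assms by (simp add: round_outcome_def)
  ultimately show "excess N f u = excess N g u + a u" "deficit N f u = deficit N g u + b u"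
    using excess_eq[of N f u] deficit_eq[of N f u] excess_eq[of N g u] deficit_eq[of N g u]
    by linarith+
qed

lemma round_outcome_blocked:
  assumes "round_outcome N S D f g a b M" "S \<subseteq> nodes N" "D \<subseteq> nodes N"
    and "u \<in> S" "v \<in> D" "excess N g u > 0" "deficit N g v > 0"
  shows "(u, v) \<notin> (residual_step N g)\<^sup>*"
proof -
  have "a u < excess N f u" "b v < deficit N f v"
    using round_outcome_imbalance[OF assms(1)] assms(2-7) by (auto simp: subset_iff)
  then show ?thesis using assms(1,4,5) by (simp add: round_outcome_def)
qed

text \<open>No edge enters the source, so a residual arc into it reverses an outgoing edge that
  carries flow. Capping the second round by the deficit of the source therefore never blocks a path
  to it.\<close>

lemma deficit_source_if_reachable:
  assumes N: "is_network N" and "(u, source N) \<in> (residual_step N f)\<^sup>*" "u \<noteq> source N"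
  shows "deficit N f (source N) > 0"
proof -
  obtain a where a: "arc_head a = source N" "residual_capacity N f a > 0"
    using assms(2,3) by (cases rule: rtranclE) (auto simp: residual_step_def)
  then obtain e where e: "e \<in> edges N" "fst e = source N" "f e > 0"
    using N by (cases a) (auto simp: is_network_def split: if_splits)
  then have "outflow N f (source N) > 0"
    unfolding outflow_def using finite_edges[OF N] by (intro sum_pos2[of _ e]) auto
  then show ?thesis
    by (simp add: deficit_def inflow_source[OF N])
qed

text \<open>Dually, a residual arc out of the sink reverses an incoming edge that carries flow, so
  the excess of the sink never blocks the third round.\<close>

lemma excess_sink_if_reachable:
  assumes N: "is_network N" and "(sink N, v) \<in> (residual_step N f)\<^sup>*" "v \<noteq> sink N"
  shows "excess N f (sink N) > 0"
proof -
  obtain a where a: "arc_tail a = sink N" "residual_capacity N f a > 0"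
    using assms(2,3) by (cases rule: converse_rtranclE) (auto simp: residual_step_def)
  then obtain e where e: "e \<in> edges N" "snd e = sink N" "f e > 0"
    using N by (cases a) (auto simp: is_network_def split: if_splits)
  then have "inflow N f (sink N) > 0"
    unfolding inflow_def using finite_edges[OF N] by (intro sum_pos2[of _ e]) auto
  then show ?thesis
    by (simp add: excess_def outflow_sink[OF N])
qed

section \<open>Elimination of all excess and all deficit\<close>

lemma net_inflow_nonneg:
  assumes "is_network N" "u \<in> nodes N" "u \<noteq> source N" "u \<notin> deficit_nodes N f"
  shows "net_inflow N f u \<ge> 0"
  using assms by (cases "u = sink N")
    (auto simp: deficit_nodes_def deficit_def net_inflow_def outflow_sink)

lemma net_inflow_nonpos:
  assumes "is_network N" "u \<in> nodes N" "u \<noteq> sink N" "u \<notin> excess_nodes N f"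
  shows "net_inflow N f u \<le> 0"
  using assms by (cases "u = source N")
    (auto simp: excess_nodes_def excess_def net_inflow_def inflow_source)

text \<open>The nodes reachable from an excess node before the second round form a saturated cut, and no
  path of the second round leaves it, so that it stays saturated. A node with remaining excess would
  then lie in a saturated cut that contains neither the source nor a deficit, although the net
  inflow of a saturated cut is not positive.\<close>

lemma excess_nodes_empty:
  assumes N: "is_network N" and f: "within_capacity N f"
    and blocked: "\<And>u v. u \<in> excess_nodes N f \<Longrightarrow> v \<in> deficit_nodes N f \<Longrightarrow>
      (u, v) \<notin> (residual_step N f)\<^sup>*"
    and outcome: "round_outcome N (excess_nodes N f) {source N} f g a b M"
  shows "excess_nodes N g = {}"
proof (rule ccontr)
  assume "excess_nodes N g \<noteq> {}"
  then obtain u where u: "u \<in> excess_nodes N g" by blast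
  define S where "S = excess_nodes N f"
  define R where "R = (residual_step N f)\<^sup>* `` S"
  define X where "X = (residual_step N g)\<^sup>* `` {u}"
  have g: "within_capacity N g"
    using outcome by (simp add: round_outcome_def)
  have inner: "S \<subseteq> nodes N - {source N, sink N}" "source N \<in> nodes N"
    using N by (auto simp: S_def excess_nodes_def is_network_def)
  have R: "R \<subseteq> nodes N" "S \<subseteq> R"
    using residual_reach_nodes[OF N, of S f] inner by (auto simp: R_def)
  have finR: "finite R" using R finite_nodes[OF N] finite_subset by blast
  have uS: "u \<in> S"
    using u round_outcome_imbalance(1)[OF outcome, of u] by (auto simp: S_def excess_nodes_def)
  have "(\<Sum>w\<in>R. net_inflow N f w) = - cut_capacity N R"
    using residual_closed_iff[OF N f finR] residual_reach_closed[of N f S] by (simp add: R_def)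
  moreover have "(\<Sum>w\<in>R. net_inflow N g w)
      = (\<Sum>w\<in>R. net_inflow N f w) - int (\<Sum>w\<in>R. a w) + int (\<Sum>w\<in>R. b w)"
    using outcome R(1)
    by (simp add: round_outcome_def subset_iff sum.distrib sum_subtractf)
  moreover have "(\<Sum>w\<in>S. a w) \<le> (\<Sum>w\<in>R. a w)"
    using R finR by (intro sum_mono2) auto
  \<comment> \<open>The source is inserted because it may lie inside or outside \<open>R\<close>;
    either way at most \<open>M\<close> units end in \<open>R\<close>.\<close>
  moreover have "(\<Sum>w\<in>R. b w) \<le> (\<Sum>w\<in>insert (source N) R. b w)"
    using finR by (intro sum_mono2) auto
  moreover have "(\<Sum>w\<in>insert (source N) R. b w) = (\<Sum>w\<in>{source N}. b w)"
  proof (rule sum.mono_neutral_right)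
    show "\<forall>w\<in>insert (source N) R - {source N}. b w = 0"
      using round_outcome_amounts(4)[OF outcome] by auto
  qed (use finR in auto)
  \<comment> \<open>All \<open>M\<close> units start in \<open>R\<close>, so its net inflow, already
    minimal, cannot have grown.\<close>
  ultimately have "(\<Sum>w\<in>R. net_inflow N g w) \<le> - cut_capacity N R"
    using outcome by (simp add: round_outcome_def S_def flip: of_nat_sum)
  then have "residual_step N g `` R \<subseteq> R"
    using residual_closed_iff[OF N g finR] sum_net_inflow_ge[OF N g finR] by linarith
  then have "(residual_step N g)\<^sup>* `` R = R"
    by (rule Image_closed_trancl)
  then have "X \<subseteq> R"
    using uS R(2) unfolding X_def by blast
  have finX: "finite X" using \<open>X \<subseteq> R\<close> finR finite_subset by blast
  have "source N \<notin> X"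
  proof
    assume "source N \<in> X"
    then have reach: "(u, source N) \<in> (residual_step N g)\<^sup>*" by (simp add: X_def)
    moreover have "deficit N g (source N) > 0"
      using deficit_source_if_reachable[OF N reach] uS inner by auto
    ultimately show False
      using round_outcome_blocked[OF outcome, of u "source N"] uS u inner
      by (auto simp: S_def excess_nodes_def)
  qed
  moreover have "w \<notin> deficit_nodes N g" if "w \<in> R" for w
  proof
    assume "w \<in> deficit_nodes N g"
    then have "w \<in> deficit_nodes N f"
      using round_outcome_imbalance(2)[OF outcome, of w] by (auto simp: deficit_nodes_def)
    with blocked that show False by (auto simp: R_def S_def)
  qed
  ultimately have "\<forall>w\<in>X. net_inflow N g w \<ge> 0"
    using \<open>X \<subseteq> R\<close> R(1) net_inflow_nonneg[OF N] by blast
  moreover have "u \<in> X" "net_inflow N g u > 0"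
    using u excess_eq[of N g u] by (auto simp: X_def excess_nodes_def)
  ultimately have "(\<Sum>w\<in>X. net_inflow N g w) > 0"
    using finX by (intro sum_pos2[of _ u]) auto
  moreover have "(\<Sum>w\<in>X. net_inflow N g w) = - cut_capacity N X"
    using residual_closed_iff[OF N g finX] residual_reach_closed[of N g "{u}"] by (simp add: X_def)
  moreover have "cut_capacity N X \<ge> 0"
    by (auto simp: cut_capacity_def intro: sum_nonneg)
  ultimately show False by linarith
qed

text \<open>The nodes \<open>Y\<close> that can reach a remaining deficit node \<open>v\<close> have
  a saturated complement. As all net inflows add up to 0, \<open>Y\<close> has net inflow at least
  0; yet without excess nodes and without the sink no node of \<open>Y\<close> has positive net
  inflow, and that of \<open>v\<close> is negative.\<close>

lemma deficit_nodes_empty: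
  assumes N: "is_network N" and no_excess: "excess_nodes N f = {}"
    and outcome: "round_outcome N {sink N} (deficit_nodes N f) f g a b M"
  shows "excess_nodes N g = {}" "deficit_nodes N g = {}"
proof -
  show no_excess': "excess_nodes N g = {}"
    using no_excess round_outcome_imbalance(1)[OF outcome] by (auto simp: excess_nodes_def)
  have g: "within_capacity N g"
    using outcome by (simp add: round_outcome_def)
  show "deficit_nodes N g = {}"
  proof (rule ccontr)
    assume "deficit_nodes N g \<noteq> {}"
    then obtain v where v: "v \<in> deficit_nodes N g" by blast
    define Y where "Y = {w \<in> nodes N. (w, v) \<in> (residual_step N g)\<^sup>*}"
    have fin: "finite (nodes N - Y)" "finite Y"
      using finite_nodes[OF N] by (auto simp: Y_def)
    have inner: "v \<in> nodes N" "v \<noteq> sink N" "sink N \<in> nodes N"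
      using N v by (auto simp: deficit_nodes_def is_network_def)
    have vD: "v \<in> deficit_nodes N f"
      using v round_outcome_imbalance(2)[OF outcome, of v] by (auto simp: deficit_nodes_def)
    have "sink N \<notin> Y"
    proof
      assume "sink N \<in> Y"
      then have reach: "(sink N, v) \<in> (residual_step N g)\<^sup>*" by (simp add: Y_def)
      moreover have "excess N g (sink N) > 0"
        using excess_sink_if_reachable[OF N reach] inner by auto
      ultimately show False
        using round_outcome_blocked[OF outcome, of "sink N" v] v vD inner
        by (auto simp: deficit_nodes_def)
    qed
    then have "\<forall>w\<in>Y. net_inflow N g w \<le> 0"
      using net_inflow_nonpos[OF N] no_excess' by (auto simp: Y_def)
    moreover have "v \<in> Y" "net_inflow N g v < 0"
      using v inner deficit_eq[of N g v] by (auto simp: Y_def deficit_nodes_def)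
    ultimately have "(\<Sum>w\<in>Y. - net_inflow N g w) > 0"
      using fin by (intro sum_pos2[of _ v]) auto
    moreover have "residual_step N g `` (nodes N - Y) \<subseteq> nodes N - Y"
      using residual_step_nodes[OF N] by (auto simp: Y_def intro: converse_rtrancl_into_rtrancl)
    then have "(\<Sum>w\<in>nodes N - Y. net_inflow N g w) = - cut_capacity N (nodes N - Y)"
      using residual_closed_iff[OF N g fin(1)] by simp
    moreover have "(\<Sum>w\<in>nodes N. net_inflow N g w)
        = (\<Sum>w\<in>nodes N - Y. net_inflow N g w) + (\<Sum>w\<in>Y. net_inflow N g w)"
      using finite_nodes[OF N] by (intro sum.subset_diff) (auto simp: Y_def)
    moreover have "cut_capacity N (nodes N - Y) \<ge> 0"
      by (auto simp: cut_capacity_def intro: sum_nonneg)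
    ultimately show False
      using sum_net_inflow_nodes[OF N, of g] by (simp add: sum_negf)
  qed
qed


section \<open>The prediction error\<close>

text \<open>A change on an edge is felt at its two ends, whence the factor 2.\<close>

lemma sum_net_inflow_diff_le:
  assumes "is_network N"
  shows "(\<Sum>u\<in>nodes N. \<bar>net_inflow N f u - net_inflow N g u\<bar>) \<le> 2 * int (l1_dist N f g)"
proof -
  have "\<bar>net_inflow N f u - net_inflow N g u\<bar>
      \<le> (\<Sum>e\<in>edges N. \<bar>int (f e) - int (g e)\<bar> * (of_bool (snd e = u) + of_bool (fst e = u)))" for u
  proof -
    have "\<bar>net_inflow N f u - net_inflow N g u\<bar> = \<bar>\<Sum>e\<in>edges N.
        (int (f e) - int (g e)) * (of_bool (snd e = u) - of_bool (fst e = u))\<bar>"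
      by (simp only: net_inflow_eq_sum[OF assms] sum_subtractf[symmetric] left_diff_distrib[symmetric])
    also have "\<dots> \<le> (\<Sum>e\<in>edges N.
        \<bar>(int (f e) - int (g e)) * (of_bool (snd e = u) - of_bool (fst e = u))\<bar>)"
      by (rule sum_abs)
    also have "\<dots> \<le> (\<Sum>e\<in>edges N.
        \<bar>int (f e) - int (g e)\<bar> * (of_bool (snd e = u) + of_bool (fst e = u)))"
      by (intro sum_mono) (auto simp: abs_mult)
    finally show ?thesis .
  qed
  then have "(\<Sum>u\<in>nodes N. \<bar>net_inflow N f u - net_inflow N g u\<bar>) \<le> (\<Sum>u\<in>nodes N. \<Sum>e\<in>edges N.
      \<bar>int (f e) - int (g e)\<bar> * (of_bool (snd e = u) + of_bool (fst e = u)))"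
    by (rule sum_mono)
  also have "\<dots> = (\<Sum>e\<in>edges N. \<Sum>u\<in>nodes N.
      \<bar>int (f e) - int (g e)\<bar> * (of_bool (snd e = u) + of_bool (fst e = u)))"
    by (rule sum.swap)
  also have "\<dots> = (\<Sum>e\<in>edges N. \<bar>int (f e) - int (g e)\<bar> * 2)"
  proof (rule sum.cong)
    fix e assume e: "e \<in> edges N"
    have "(\<Sum>u\<in>nodes N. of_bool (w = u) :: int) = 1" if "w \<in> nodes N" for w
      using finite_nodes[OF assms] that by (simp add: of_bool_def)
    then show "(\<Sum>u\<in>nodes N. \<bar>int (f e) - int (g e)\<bar> * (of_bool (snd e = u) + of_bool (fst e = u)))
        = \<bar>int (f e) - int (g e)\<bar> * 2"
      using edge_nodes[OF assms e] by (simp only: sum_distrib_left[symmetric] sum.distrib) simp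
  qed simp
  also have "\<dots> = 2 * int (l1_dist N f g)"
    by (simp add: l1_dist_def sum_distrib_left mult.commute)
  finally show ?thesis .
qed

text \<open>Clipping moves each entry towards any flow that respects the capacities.\<close>

lemma l1_dist_clip:
  assumes "within_capacity N g"
  shows "l1_dist N (clip N f) g \<le> l1_dist N f g"
  unfolding l1_dist_def
  using assms by (intro sum_mono) (auto simp: clip_def within_capacity_def)

text \<open>The maximum flow \<open>g\<close> ensures that the infimum is over a nonempty set; in
  use it is the output of the algorithm itself.\<close>

lemma prediction_error_attained:
  assumes "max_flow N g"
  obtains fs where "max_flow N fs" "l1_dist N f fs = prediction_error N f"
proof -
  have "l1_dist N f ` {fs. max_flow N fs} \<noteq> {}" using assms by blast
  from Inf_nat_def1[OF this] show ?thesis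
    using that by (auto simp: prediction_error_def)
qed

section \<open>Analysis of a complete run\<close>

context priced_subroutine
begin

text \<open>The times of the four phases are kept apart because the worst-case time enters at two
  different network sizes.\<close>

lemma seeded_ford_fulkerson_run:
  assumes N: "is_network N" and "seeded_ford_fulkerson A N f g \<tau>"
  shows "max_flow N g \<and>
    \<tau> \<le> 30 * (K + 5) * (max 1 (card (edges N)) * max 1 (prediction_error N f)) \<and>
    (\<exists>\<tau>1 \<tau>2 \<tau>3 \<tau>4. \<tau> = 1 + card (edges N) + \<tau>1 + \<tau>2 + \<tau>3 + \<tau>4 \<and> 1 + card (edges N) \<le> \<tau>4 \<and>
      enat \<tau>4 \<le> ff_worst_time A (card (nodes N)) (card (edges N)) \<and>
      (\<forall>\<tau>'\<in>{\<tau>1, \<tau>2, \<tau>3}.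
        enat \<tau>' \<le> ff_worst_time A (card (nodes N) + 2) (3 * max 1 (card (edges N)))))"
proof -
  obtain f0 f1 f2 f3 \<tau>1 \<tau>2 \<tau>3 \<tau>4 where f0: "f0 = clip N f"
    and run1: "projection_round A N (excess_nodes N f0) (deficit_nodes N f0) f0 f1 \<tau>1"
    and run2: "projection_round A N (excess_nodes N f1) {source N} f1 f2 \<tau>2"
    and run3: "projection_round A N {sink N} (deficit_nodes N f2) f2 f3 \<tau>3"
    and run4: "ford_fulkerson A N f3 g \<tau>4"
    and \<tau>: "\<tau> = 1 + card (edges N) + \<tau>1 + \<tau>2 + \<tau>3 + \<tau>4"
    using assms(2) unfolding seeded_ford_fulkerson_def by blast
  let ?m = "max 1 (card (edges N))" and ?s = "source N" and ?t = "sink N"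
  let ?I = "nodes N - {source N, sink N}"
  have fin: "finite ?I" using finite_nodes[OF N] by simp
  have st: "?s \<in> nodes N" "?t \<in> nodes N" "?s \<noteq> ?t" using N by (auto simp: is_network_def)
  have SD: "excess_nodes N h \<subseteq> nodes N" "deficit_nodes N h \<subseteq> nodes N"
    "{?s} \<subseteq> nodes N" "{?t} \<subseteq> nodes N" for h
    using st by (auto simp: excess_nodes_def deficit_nodes_def)
  have cards: "card (excess_nodes N h) \<le> ?m" "card (deficit_nodes N h) \<le> ?m"
    "card {?s} \<le> ?m" "card {?t} \<le> ?m" for h
    using card_excess_nodes[OF N, of h] card_deficit_nodes[OF N, of h] by auto
  have w0: "within_capacity N f0" unfolding f0 by (rule within_capacity_clip)
  obtain a1 b1 M1 where
      o1: "round_outcome N (excess_nodes N f0) (deficit_nodes N f0) f0 f1 a1 b1 M1"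
    and t1: "\<tau>1 \<le> 3 * (K + 4) * ?m * (M1 + 1)"
    using projection_round_outcome[OF N w0 SD(1,2) cards(1,2) run1] by blast
  have w1: "within_capacity N f1" using o1 by (simp add: round_outcome_def)
  obtain a2 b2 M2 where o2: "round_outcome N (excess_nodes N f1) {?s} f1 f2 a2 b2 M2"
    and t2: "\<tau>2 \<le> 3 * (K + 4) * ?m * (M2 + 1)"
    using projection_round_outcome[OF N w1 SD(1,3) cards(1,3) run2] by blast
  have w2: "within_capacity N f2" using o2 by (simp add: round_outcome_def)
  obtain a3 b3 M3 where o3: "round_outcome N {?t} (deficit_nodes N f2) f2 f3 a3 b3 M3"
    and t3: "\<tau>3 \<le> 3 * (K + 4) * ?m * (M3 + 1)"
    using projection_round_outcome[OF N w2 SD(4,2) cards(4,2) run3] by blast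
  have w3: "within_capacity N f3" using o3 by (simp add: round_outcome_def)
  obtain M4 where s4: "sends N f3 M4 g" and stuck: "(?s, ?t) \<notin> (residual_step N g)\<^sup>*"
    and t4: "\<tau>4 \<le> (K + 4) * ?m * (M4 + 1)"
    using ford_fulkerson_sends[OF N w3 run4] by blast
  note im1 = round_outcome_imbalance[OF o1] and im2 = round_outcome_imbalance[OF o2]
    and im3 = round_outcome_imbalance[OF o3]

  \<comment> \<open>Imbalance left after the first round was present before it, so its stopping
    condition covers the current excess and deficit nodes.\<close>
  have "(u, v) \<notin> (residual_step N f1)\<^sup>*"
    if "u \<in> excess_nodes N f1" "v \<in> deficit_nodes N f1" for u v
    using round_outcome_blocked[OF o1 SD(1,2), of u v] that im1[of u] im1[of v]
    by (auto simp: excess_nodes_def deficit_nodes_def)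
  then have "excess_nodes N f2 = {}"
    by (rule excess_nodes_empty[OF N w1 _ o2])
  then have "excess_nodes N f3 = {}" "deficit_nodes N f3 = {}"
    using deficit_nodes_empty[OF N _ o3] by simp_all
  then have "net_inflow N f3 u = 0" if "u \<in> ?I" for u
    using net_inflow_nonneg[OF N, of u f3] net_inflow_nonpos[OF N, of u f3] that by auto
  then have "net_inflow N g u = 0" if "u \<in> ?I" for u
    using s4 that by (simp add: sends_def)
  then have "feasible N g"
    using s4 by (simp add: feasible_def sends_def net_inflow_def)
  then have max: "max_flow N g"
    using stuck by (rule max_flow_if_sink_unreachable[OF N])

  obtain fs where fs: "max_flow N fs" "l1_dist N f fs = prediction_error N f"
    using prediction_error_attained[OF max] .
  let ?\<eta> = "prediction_error N f"
  have "l1_dist N f0 fs \<le> ?\<eta>"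
    using l1_dist_clip[of N fs f] fs by (simp add: f0 max_flow_def feasible_def)
  then have "(\<Sum>u\<in>nodes N. \<bar>net_inflow N f0 u - net_inflow N fs u\<bar>) \<le> 2 * int ?\<eta>"
    using sum_net_inflow_diff_le[OF N, of f0 fs] by linarith
  moreover have "(\<Sum>u\<in>insert ?s ?I. \<bar>net_inflow N f0 u - net_inflow N fs u\<bar>)
      \<le> (\<Sum>u\<in>nodes N. \<bar>net_inflow N f0 u - net_inflow N fs u\<bar>)"
    using finite_nodes[OF N] st by (intro sum_mono2) auto
  moreover have "(\<Sum>u\<in>?I. \<bar>net_inflow N f0 u - net_inflow N fs u\<bar>)
      = int (\<Sum>u\<in>?I. excess N f0 u) + int (\<Sum>u\<in>?I. deficit N f0 u)"
    unfolding of_nat_sum sum.distrib[symmetric]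
  proof (rule sum.cong)
    fix u assume "u \<in> ?I"
    then have "net_inflow N fs u = 0"
      using fs by (simp add: max_flow_def feasible_def net_inflow_def)
    then show "\<bar>net_inflow N f0 u - net_inflow N fs u\<bar> = int (excess N f0 u) + int (deficit N f0 u)"
      by (auto simp: excess_eq deficit_eq)
  qed simp
  \<comment> \<open>One budget of \<open>2 * \<eta>\<close> covers the gap in flow value at the
    source together with all inner imbalance.\<close>
  ultimately have error: "\<bar>net_inflow N f0 ?s - net_inflow N fs ?s\<bar>
      + int (\<Sum>u\<in>?I. excess N f0 u) + int (\<Sum>u\<in>?I. deficit N f0 u) \<le> 2 * int ?\<eta>"
    using fin by (simp add: sum.insert)

  have "M1 = (\<Sum>u\<in>excess_nodes N f0. a1 u)" using o1 by (simp add: round_outcome_def)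
  also have "\<dots> \<le> (\<Sum>u\<in>?I. a1 u)"
    using fin excess_nodes_subset by (intro sum_mono2) auto
  also have "\<dots> \<le> (\<Sum>u\<in>?I. excess N f0 u)"
    using im1 by (intro sum_mono) auto
  finally have M1: "M1 \<le> (\<Sum>u\<in>?I. excess N f0 u)" .
  have "M2 = (\<Sum>u\<in>excess_nodes N f1. a2 u)" using o2 by (simp add: round_outcome_def)
  also have "\<dots> \<le> (\<Sum>u\<in>?I. a2 u)"
    using fin excess_nodes_subset by (intro sum_mono2) auto
  also have "\<dots> \<le> (\<Sum>u\<in>?I. excess N f0 u)"
    using im1 im2 by (intro sum_mono) auto
  finally have M2: "M2 \<le> (\<Sum>u\<in>?I. excess N f0 u)" .
  have "M3 = (\<Sum>u\<in>deficit_nodes N f2. b3 u)" using o3 by (simp add: round_outcome_def)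
  also have "\<dots> \<le> (\<Sum>u\<in>?I. b3 u)"
    using fin deficit_nodes_subset by (intro sum_mono2) auto
  also have "\<dots> \<le> (\<Sum>u\<in>?I. deficit N f0 u)"
    using im1 im2 im3 by (intro sum_mono) auto
  finally have M3: "M3 \<le> (\<Sum>u\<in>?I. deficit N f0 u)" .

  have ns: "?s \<notin> excess_nodes N h" "?s \<notin> deficit_nodes N h" for h
    by (auto simp: excess_nodes_def deficit_nodes_def)
  \<comment> \<open>The net inflow of the source is followed through all phases: only the second
    round raises it, by \<open>M2\<close>, and the last phase lowers it by \<open>M4\<close>. It
    cannot fall below that of \<open>fs\<close>, whose value is maximum.\<close>
  have "net_inflow N f1 ?s = net_inflow N f0 ?s - int (a1 ?s) + int (b1 ?s)"
    "a1 ?s = 0" "b1 ?s = 0"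
    using o1 st ns round_outcome_amounts(3,4)[OF o1] by (auto simp: round_outcome_def)
  moreover have "net_inflow N f2 ?s = net_inflow N f1 ?s - int (a2 ?s) + int (b2 ?s)"
    "a2 ?s = 0" "b2 ?s = M2"
    using o2 st ns round_outcome_amounts(3)[OF o2] by (auto simp: round_outcome_def)
  moreover have "net_inflow N f3 ?s = net_inflow N f2 ?s - int (a3 ?s) + int (b3 ?s)"
    "a3 ?s = 0" "b3 ?s = 0"
    using o3 st ns round_outcome_amounts(3,4)[OF o3] by (auto simp: round_outcome_def)
  moreover have "net_inflow N g ?s = net_inflow N f3 ?s - int M4"
    using s4 st by (simp add: sends_def)
  moreover have "net_inflow N fs ?s \<le> net_inflow N g ?s"
    using fs(1) \<open>feasible N g\<close> by (simp add: net_inflow_source[OF N] max_flow_def)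
  ultimately have "int M4 \<le> \<bar>net_inflow N f0 ?s - net_inflow N fs ?s\<bar> + int M2"
    by linarith
  \<comment> \<open>The source gap and \<open>M2\<close> are charged to the same budget, so
    \<open>M4\<close> obeys the same bound as the other amounts.\<close>
  then have M_le: "M1 \<le> 2 * ?\<eta>" "M2 \<le> 2 * ?\<eta>" "M3 \<le> 2 * ?\<eta>" "M4 \<le> 2 * ?\<eta>"
    using error M1 M2 M3 by linarith+
  \<comment> \<open>Here \<open>2 * \<eta> + 1\<close> is at most
    \<open>3 * max 1 \<eta>\<close>.\<close>
  have bound: "c * ?m * (M + 1) \<le> c * ?m * (3 * max 1 ?\<eta>)" if "M \<le> 2 * ?\<eta>" for c M
    using that by (intro mult_left_mono) auto
  have "\<tau>1 \<le> 3 * (K + 4) * ?m * (3 * max 1 ?\<eta>)" "\<tau>2 \<le> 3 * (K + 4) * ?m * (3 * max 1 ?\<eta>)"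
    "\<tau>3 \<le> 3 * (K + 4) * ?m * (3 * max 1 ?\<eta>)" "\<tau>4 \<le> (K + 4) * ?m * (3 * max 1 ?\<eta>)"
    by (rule order.trans[OF t1 bound[OF M_le(1)]] order.trans[OF t2 bound[OF M_le(2)]]
        order.trans[OF t3 bound[OF M_le(3)]] order.trans[OF t4 bound[OF M_le(4)]])+
  moreover have "1 + card (edges N) \<le> 2 * ?m * max 1 ?\<eta>"
  proof -
    have "1 + card (edges N) \<le> 2 * ?m * 1" by simp
    also have "\<dots> \<le> 2 * ?m * max 1 ?\<eta>" by (intro mult_left_mono) auto
    finally show ?thesis .
  qed
  ultimately have "\<tau> \<le> 2 * ?m * max 1 ?\<eta> + 3 * (3 * (K + 4) * ?m * (3 * max 1 ?\<eta>))
      + (K + 4) * ?m * (3 * max 1 ?\<eta>)"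
    unfolding \<tau> by linarith
  \<comment> \<open>Each of the three rounds contributes \<open>9 * (K + 4)\<close>, the last phase
    \<open>3 * (K + 4)\<close>, and clipping 2.\<close>
  also have "\<dots> = (2 + 30 * (K + 4)) * (?m * max 1 ?\<eta>)"
    by (simp add: algebra_simps)
  also have "\<dots> \<le> 30 * (K + 5) * (?m * max 1 ?\<eta>)"
    by (rule mult_right_mono) auto
  finally have time: "\<tau> \<le> 30 * (K + 5) * (?m * max 1 ?\<eta>)" .

  have "enat \<tau>4 \<le> ff_worst_time A (card (nodes N)) (card (edges N))"
    unfolding ff_worst_time_def using N w3 run4 by (intro SUP_upper) blast
  moreover have "1 + card (edges N) \<le> \<tau>4"
    using run4 by (auto simp: ford_fulkerson_def)
  moreover have "enat \<tau>' \<le> ff_worst_time A (card (nodes N) + 2) (3 * ?m)" if "\<tau>' \<in> {\<tau>1, \<tau>2, \<tau>3}" for \<tau>'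
    using that projection_round_time[OF N w0 SD(1,2) cards(1,2) run1]
      projection_round_time[OF N w1 SD(1,3) cards(1,3) run2]
      projection_round_time[OF N w2 SD(4,2) cards(4,2) run3] by blast
  ultimately show ?thesis
    using max time \<tau> by blast
qed

lemma seeded_ford_fulkerson_exists:
  assumes N: "is_network N"
  shows "\<exists>g \<tau>. seeded_ford_fulkerson A N f g \<tau>"
proof -
  have round: "\<exists>g \<tau>. projection_round A N S D h g \<tau> \<and> within_capacity N g"
    if pre: "within_capacity N h" "S \<subseteq> nodes N" "D \<subseteq> nodes N"
      "card S \<le> max 1 (card (edges N))" "card D \<le> max 1 (card (edges N))" for S D h
  proof -
    obtain g \<tau> where run: "projection_round A N S D h g \<tau>"
      using projection_round_exists[OF N pre(1-3)] by blast
    then obtain a b M where "round_outcome N S D h g a b M"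
      using projection_round_outcome[OF N pre run] by blast
    with run show ?thesis by (auto simp: round_outcome_def)
  qed
  have SD: "excess_nodes N h \<subseteq> nodes N" "deficit_nodes N h \<subseteq> nodes N"
    "{source N} \<subseteq> nodes N" "{sink N} \<subseteq> nodes N" for h
    using N by (auto simp: excess_nodes_def deficit_nodes_def is_network_def)
  have cards: "card (excess_nodes N h) \<le> max 1 (card (edges N))"
    "card (deficit_nodes N h) \<le> max 1 (card (edges N))"
    "card {source N} \<le> max 1 (card (edges N))" "card {sink N} \<le> max 1 (card (edges N))" for h
    using card_excess_nodes[OF N, of h] card_deficit_nodes[OF N, of h] by auto
  define f0 where "f0 = clip N f"
  have w0: "within_capacity N f0" unfolding f0_def by (rule within_capacity_clip)
  obtain f1 \<tau>1 where r1: "projection_round A N (excess_nodes N f0) (deficit_nodes N f0) f0 f1 \<tau>1"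
    and w1: "within_capacity N f1"
    using round[OF w0 SD(1,2) cards(1,2)] by blast
  obtain f2 \<tau>2 where r2: "projection_round A N (excess_nodes N f1) {source N} f1 f2 \<tau>2"
    and w2: "within_capacity N f2"
    using round[OF w1 SD(1,3) cards(1,3)] by blast
  obtain f3 \<tau>3 where r3: "projection_round A N {sink N} (deficit_nodes N f2) f2 f3 \<tau>3"
    and w3: "within_capacity N f3"
    using round[OF w2 SD(4,2) cards(4,2)] by blast
  obtain g \<tau>4 where "ford_fulkerson A N f3 g \<tau>4"
    using ford_fulkerson_exists[OF N w3] by blast
  with r1 r2 r3 show ?thesis
    unfolding seeded_ford_fulkerson_def f0_def by blast
qed

end

text \<open>\<open>T\<close> is any upper bound on the worst-case time that tolerates the size of
  the auxiliary networks. Since runs form a relation, their existence is asserted next to the bound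
  on all of them. The \<open>max 1\<close> accounts for work done even on a perfect prediction or
  without edges.\<close>

theorem theorem1:
  fixes A :: subroutine and T :: "nat \<Rightarrow> nat \<Rightarrow> enat"
  assumes "augmenting_subroutine A"
    and "\<And>n m. ff_worst_time A n m \<le> T n m"
    and "\<exists>\<kappa>::nat. \<forall>n\<ge>2. \<forall>m\<ge>1. T (n + 2) (3 * m) \<le> enat \<kappa> * T n m"
  shows "\<exists>C::nat. \<forall>N fh. is_network N \<longrightarrow>
           (\<exists>g \<tau>. seeded_ford_fulkerson A N fh g \<tau>) \<and>
           (\<forall>g \<tau>. seeded_ford_fulkerson A N fh g \<tau> \<longrightarrow>
              max_flow N g \<and>
              enat \<tau> \<le> enat C * min (enat (max 1 (card (edges N)) * max 1 (prediction_error N fh)))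
                                   (T (card (nodes N)) (card (edges N))))"
proof -
  obtain K where "priced_subroutine A K"
    using assms(1) unfolding augmenting_subroutine_def priced_subroutine_def by blast
  then interpret priced_subroutine A K .
  obtain \<kappa> :: nat where \<kappa>: "\<And>n m. n \<ge> 2 \<Longrightarrow> m \<ge> 1 \<Longrightarrow> T (n + 2) (3 * m) \<le> enat \<kappa> * T n m"
    using assms(3) by blast
  \<comment> \<open>The first summand serves the error bound, \<open>3 * \<kappa>\<close> the three
    rounds, and 2 the last phase and clipping.\<close>
  define C where "C = 30 * (K + 5) + 3 * \<kappa> + 2"
  have "max_flow N g \<and>
      enat \<tau> \<le> enat C * min (enat (max 1 (card (edges N)) * max 1 (prediction_error N fh)))
                           (T (card (nodes N)) (card (edges N)))"
    if N: "is_network N" and run: "seeded_ford_fulkerson A N fh g \<tau>" for N fh g \<tau>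
  proof -
    let ?n = "card (nodes N)" and ?m = "card (edges N)"
    let ?T = "T ?n ?m"
    note result = seeded_ford_fulkerson_run[OF N run]
    then obtain \<tau>1 \<tau>2 \<tau>3 \<tau>4 where \<tau>: "\<tau> = 1 + ?m + \<tau>1 + \<tau>2 + \<tau>3 + \<tau>4" and \<tau>4: "1 + ?m \<le> \<tau>4"
      and T4: "enat \<tau>4 \<le> ff_worst_time A ?n ?m"
      and T': "\<And>\<tau>'. \<tau>' \<in> {\<tau>1, \<tau>2, \<tau>3} \<Longrightarrow> enat \<tau>' \<le> ff_worst_time A (?n + 2) (3 * max 1 ?m)"
      by blast
    have "30 * (K + 5) * (max 1 ?m * max 1 (prediction_error N fh))
        \<le> C * (max 1 ?m * max 1 (prediction_error N fh))"
      unfolding C_def by (rule mult_right_mono) auto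
    then have by_error: "\<tau> \<le> C * (max 1 ?m * max 1 (prediction_error N fh))"
      using result by linarith
    have "enat \<tau> \<le> enat C * ?T"
    proof (cases ?T)
      case (enat x)
      have x: "\<tau>4 \<le> x"
        using order.trans[OF T4 assms(2)] by (simp add: enat)
      \<comment> \<open>Growth of \<open>T\<close> is controlled only from one edge on. Without
        edges the prediction error is 0, so the error bound makes the time constant, while
        \<open>x\<close> is at least 1.\<close>
      show ?thesis
      proof (cases "edges N = {}")
        case True
        then have "l1_dist N fh h = 0" for h by (simp add: l1_dist_def)
        then have "prediction_error N fh = 0"
          using prediction_error_attained[of N g fh] result by metis
        then have "\<tau> \<le> C * 1" using by_error True by simp
        also have "\<dots> \<le> C * x" using \<tau>4 x by (intro mult_left_mono) auto
        finally show ?thesis by (simp add: enat)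
      next
        case False
        then have m: "?m \<ge> 1" using finite_edges[OF N] by (simp add: Suc_le_eq card_gt_0_iff)
        have "card {source N, sink N} \<le> ?n"
          using N finite_nodes[OF N] by (intro card_mono) (auto simp: is_network_def)
        then have n: "?n \<ge> 2" using N by (simp add: is_network_def)
        have "\<tau>' \<le> \<kappa> * x" if "\<tau>' \<in> {\<tau>1, \<tau>2, \<tau>3}" for \<tau>'
        proof -
          have "enat \<tau>' \<le> T (?n + 2) (3 * ?m)"
            using order.trans[OF T'[OF that] assms(2)] m by (simp add: max_def)
          also have "\<dots> \<le> enat \<kappa> * enat x"
            using \<kappa>[OF n m] by (simp add: enat)
          finally show ?thesis by simp
        qed
        \<comment> \<open>Clipping costs at most \<open>\<tau>4\<close>, hence at most
          \<open>x\<close>, like the last phase.\<close>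
        from this[of \<tau>1] this[of \<tau>2] this[of \<tau>3] have "\<tau> \<le> 3 * (\<kappa> * x) + 2 * x"
          using \<tau> \<tau>4 x by simp
        also have "\<dots> = (3 * \<kappa> + 2) * x" by (simp add: algebra_simps)
        also have "\<dots> \<le> C * x" unfolding C_def by (rule mult_right_mono) auto
        finally show ?thesis by (simp add: enat)
      qed
    next
      \<comment> \<open>The product with infinity is infinite because \<open>C\<close> is
        positive.\<close>
      case infinity
      then show ?thesis by (simp add: C_def times_enat_def enat_0_iff)
    qed
    then show ?thesis
      using result by_error by (simp add: min_def)
  qed
  then show ?thesis
    using seeded_ford_fulkerson_exists by blast
qed

end
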